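(* Let $\mathbb{A}$ be an Azumaya algebra over its center $R:=\mathcal{Z}(\mathbb{A})$. Then $\mathbb{A}$ is strongly left Jacobson if and only if $R$ is Jacobson.
   Context: All rings and algebras are associative and unital. A ring $\mathbb{A}$ is an Azumaya algebra over its center $R$ if it is a separable algebra over $R=\mathcal{Z}(\mathbb{A})$. A left ideal $I$ of a ring $\mathbb{A}$ is semiprime if for every $a\in\mathbb{A}$ with $a\mathbb{A}a\subseteq I$ we have $a\in I$. A ring is strongly left Jacobson if every semiprime left ideal is an intersection of maximal left ideals (the empty intersection being the whole ring). A commutative ring is Jacobson if every prime ideal is an intersection of maximal ideals. *)

theory Defs
  imports "HOL-Algebra.Algebra"
begin

locale left_ideal = additive_subgroup I A + ring A for I and A (structure) +
  assumes l_closed: "\<lbrakk>x \<in> I; a \<in> carrier A\<rbrakk> \<Longrightarrow> a \<otimes> x \<in> I"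

locale maximal_left_ideal = left_ideal +
  assumes notcarr: "carrier A \<noteq> I"
    and maximal: "\<lbrakk>left_ideal J A; I \<subseteq> J\<rbrakk> \<Longrightarrow> J = I \<or> J = carrier A"

locale semiprime_left_ideal = left_ideal +
  assumes semiprime: "\<lbrakk>a \<in> carrier A; \<And>x. x \<in> carrier A \<Longrightarrow> a \<otimes> x \<otimes> a \<in> I\<rbrakk> \<Longrightarrow> a \<in> I"

text \<open>Intersections below are taken inside the carrier, so that the empty intersection is the
  whole ring.\<close>

locale strongly_left_jacobson = ring A for A (structure) +
  assumes semiprime_is_Inter:
    "semiprime_left_ideal I A \<Longrightarrow>
      \<exists>\<M>. (\<forall>M \<in> \<M>. maximal_left_ideal M A) \<and> I = carrier A \<inter> \<Inter>\<M>"

locale jacobson_cring = cring R for R (structure) +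
  assumes prime_is_Inter:
    "primeideal P R \<Longrightarrow>
      \<exists>\<M>. (\<forall>M \<in> \<M>. maximalideal M R) \<and> P = carrier R \<inter> \<Inter>\<M>"

definition ring_center :: "('a, 'm) ring_scheme \<Rightarrow> 'a set"
  where "ring_center A =
    {z \<in> carrier A. \<forall>a \<in> carrier A. z \<otimes>\<^bsub>A\<^esub> a = a \<otimes>\<^bsub>A\<^esub> z}"

lemma (in ring) ring_center_subring: "subring (ring_center R) R"
proof (rule subringI)
  show "ring_center R \<subseteq> carrier R" "\<one> \<in> ring_center R"
    by (auto simp: ring_center_def)
next
  fix x assume "x \<in> ring_center R"
  then show "\<ominus> x \<in> ring_center R"
    by (simp add: ring_center_def l_minus r_minus)
next
  fix x y assume xy: "x \<in> ring_center R" "y \<in> ring_center R"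
  then show "x \<oplus> y \<in> ring_center R"
    by (simp add: ring_center_def l_distr r_distr)
  have x: "x \<in> carrier R" and y: "y \<in> carrier R"
    using xy by (simp_all add: ring_center_def)
  have "(x \<otimes> y) \<otimes> a = a \<otimes> (x \<otimes> y)" if a: "a \<in> carrier R" for a
  proof -
    have "(x \<otimes> y) \<otimes> a = x \<otimes> (y \<otimes> a)" by (rule m_assoc[OF x y a])
    also have "y \<otimes> a = a \<otimes> y" using xy a unfolding ring_center_def by blast
    also have "x \<otimes> (a \<otimes> y) = (x \<otimes> a) \<otimes> y" by (rule m_assoc[OF x a y, symmetric])
    also have "x \<otimes> a = a \<otimes> x" using xy a unfolding ring_center_def by blast
    also have "(a \<otimes> x) \<otimes> y = a \<otimes> (x \<otimes> y)" by (rule m_assoc[OF a x y])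
    finally show ?thesis .
  qed
  then show "x \<otimes> y \<in> ring_center R"
    using x y by (simp add: ring_center_def)
qed

lemma (in ring) ring_center_subcring: "subcring (ring_center R) R"
proof (intro subcring.intro subcring_axioms.intro ring_center_subring)
  fix x y assume "x \<in> ring_center R" "y \<in> ring_center R"
  then show "x \<otimes> y = y \<otimes> x"
    unfolding ring_center_def by blast
qed

text \<open>\<open>A \<otimes>\<^sub>K A\<close> is the free abelian group on \<open>carrier A \<times> carrier A\<close>, with the pair \<open>(x, y)\<close>
  standing for \<open>x \<otimes> y\<close>, modulo biadditivity and \<open>K\<close>-balancedness.\<close>

definition tensor_rels :: "'a set \<Rightarrow> ('a, 'm) ring_scheme \<Rightarrow> ('a \<times> 'a \<Rightarrow>\<^sub>0 int) set"
  where "tensor_rels K A =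
    {frag_of (x \<oplus>\<^bsub>A\<^esub> x', y) - frag_of (x, y) - frag_of (x', y) | x x' y.
        x \<in> carrier A \<and> x' \<in> carrier A \<and> y \<in> carrier A} \<union>
    {frag_of (x, y \<oplus>\<^bsub>A\<^esub> y') - frag_of (x, y) - frag_of (x, y') | x y y'.
        x \<in> carrier A \<and> y \<in> carrier A \<and> y' \<in> carrier A} \<union>
    {frag_of (x \<otimes>\<^bsub>A\<^esub> k, y) - frag_of (x, k \<otimes>\<^bsub>A\<^esub> y) | x k y.
        x \<in> carrier A \<and> k \<in> K \<and> y \<in> carrier A}"

abbreviation free_square :: "('a, 'm) ring_scheme \<Rightarrow> ('a \<times> 'a \<Rightarrow>\<^sub>0 int) monoid"
  where "free_square A \<equiv> free_Abelian_group (carrier A \<times> carrier A)"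

definition tensor_null :: "'a set \<Rightarrow> ('a, 'm) ring_scheme \<Rightarrow> ('a \<times> 'a \<Rightarrow>\<^sub>0 int) set"
  where "tensor_null K A = generate (free_square A) (tensor_rels K A)"

definition tensor_square :: "'a set \<Rightarrow> ('a, 'm) ring_scheme \<Rightarrow> ('a \<times> 'a \<Rightarrow>\<^sub>0 int) set monoid"
  where "tensor_square K A = free_square A Mod tensor_null K A"

text \<open>Below, \<open>tensor_act K A a b\<close> is \<open>x \<otimes> y \<mapsto> ax \<otimes> yb\<close>, the bimodule structure, and
  \<open>tensor_mult A\<close> is \<open>x \<otimes> y \<mapsto> xy\<close>. On the quotient, \<open>the_elem\<close> picks the value common to all
  representatives of a coset.\<close>

definition frag_act :: "('a, 'm) ring_scheme \<Rightarrow> 'a \<Rightarrow> 'a \<Rightarrow> ('a \<times> 'a \<Rightarrow>\<^sub>0 int) \<Rightarrow> ('a \<times> 'a \<Rightarrow>\<^sub>0 int)"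
  where "frag_act A a b = frag_extend (\<lambda>(x, y). frag_of (a \<otimes>\<^bsub>A\<^esub> x, y \<otimes>\<^bsub>A\<^esub> b))"

definition tensor_act ::
  "'a set \<Rightarrow> ('a, 'm) ring_scheme \<Rightarrow> 'a \<Rightarrow> 'a \<Rightarrow> ('a \<times> 'a \<Rightarrow>\<^sub>0 int) set \<Rightarrow> ('a \<times> 'a \<Rightarrow>\<^sub>0 int) set"
  where "tensor_act K A a b T =
    the_elem ((\<lambda>c. tensor_null K A #>\<^bsub>free_square A\<^esub> frag_act A a b c) ` T)"

definition frag_mult :: "('a, 'm) ring_scheme \<Rightarrow> ('a \<times> 'a \<Rightarrow>\<^sub>0 int) \<Rightarrow> 'a"
  where "frag_mult A c =
    (\<Oplus>\<^bsub>A\<^esub>p \<in> Poly_Mapping.keys c. add_pow A (Poly_Mapping.lookup c p) (fst p \<otimes>\<^bsub>A\<^esub> snd p))"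

definition tensor_mult :: "('a, 'm) ring_scheme \<Rightarrow> ('a \<times> 'a \<Rightarrow>\<^sub>0 int) set \<Rightarrow> 'a"
  where "tensor_mult A T = the_elem (frag_mult A ` T)"

text \<open>\<open>A\<close> is separable over \<open>K\<close> when the multiplication map \<open>A \<otimes>\<^sub>K A \<rightarrow> A\<close> splits as a map of
  \<open>A\<close>-\<open>A\<close>-bimodules, i.e. \<open>A\<close> is projective over \<open>A \<otimes>\<^sub>K A\<^sup>o\<^sup>p\<close>.\<close>

locale separable_algebra = ring A for K and A (structure) +
  assumes base_subring: "subring K A"
    and base_central: "K \<subseteq> ring_center A"
    and bimodule_section: "\<exists>\<sigma> \<in> hom (add_monoid A) (tensor_square K A).
      (\<forall>a \<in> carrier A. \<forall>x \<in> carrier A. \<forall>b \<in> carrier A.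
          \<sigma> (a \<otimes> x \<otimes> b) = tensor_act K A a b (\<sigma> x)) \<and>
      (\<forall>x \<in> carrier A. tensor_mult A (\<sigma> x) = x)"

definition azumaya_over_center :: "('a, 'm) ring_scheme \<Rightarrow> bool"
  where "azumaya_over_center A \<longleftrightarrow> separable_algebra (ring_center A) A"

end

theory Submission
  imports Defs
begin

text \<open>Write \<open>Z\<close> for the center. A separability element \<open>e = \<Sum> x\<^sub>i \<otimes> y\<^sub>i\<close> yields the \<open>Z\<close>-linear
  retraction \<open>tr a = \<Sum> x\<^sub>i a y\<^sub>i\<close> of \<open>A\<close> onto \<open>Z\<close>. For a prime \<open>P\<close> of \<open>Z\<close>, averaging a linear
  projection onto a left ideal \<open>I\<close> with \<open>e\<close>, over the fraction field of \<open>Z/P\<close>, shows that \<open>I\<close> is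
  generated by an idempotent there: there are \<open>i \<in> I\<close> and \<open>d \<in> Z - P\<close> with \<open>x i \<equiv> d x\<close> for all
  \<open>x \<in> I\<close>. For a two-sided ideal, \<open>tr i\<close> is such an element too, so every ideal that does not vanish
  over that field meets \<open>Z - P\<close>.

  Let \<open>Z\<close> be Jacobson, \<open>I\<close> semiprime and \<open>a \<notin> I\<close>. For a prime \<open>P\<close> minimal over
  \<open>{r \<in> Z. r a \<in> I}\<close> one has \<open>s a \<notin> I + P A\<close> for all \<open>s \<in> Z - P\<close>: otherwise
  \<open>w = u (s a - i) \<in> P A\<close> satisfies \<open>w A w \<subseteq> I\<close> for a suitable \<open>u \<in> Z - P\<close>. So \<open>a i - d a\<close> does not
  vanish over the fraction field, and the ideal it generates contains some \<open>r \<in> Z - P\<close>; for a maximal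
  ideal \<open>m \<supseteq> P\<close> with \<open>r \<notin> m\<close> one gets \<open>a \<notin> I + m A\<close>, and over the field \<open>Z/m\<close> left ideals
  are intersections of maximal ones. Conversely, \<open>P\<close> is the contraction of the semiprime ideal of
  elements vanishing over the fraction field of \<open>Z/P\<close>, and maximal left ideals contract to maximal
  ideals of \<open>Z\<close>.\<close>

section \<open>Separability elements\<close>

text \<open>The homomorphism out of the free abelian group with prescribed values on the generators.
  Maps on the tensor square are handled as such homomorphisms that respect the relations.\<close>

definition frag_lin :: "('a, 'm) ring_scheme \<Rightarrow> ('b \<Rightarrow> 'a) \<Rightarrow> ('b \<Rightarrow>\<^sub>0 int) \<Rightarrow> 'a"
  where "frag_lin A f c =
    (\<Oplus>\<^bsub>A\<^esub>p \<in> Poly_Mapping.keys c. add_pow A (Poly_Mapping.lookup c p) (f p))"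

lemma frag_mult_eq_frag_lin: "frag_mult A = frag_lin A (\<lambda>p. fst p \<otimes>\<^bsub>A\<^esub> snd p)"
  by (simp add: fun_eq_iff frag_mult_def frag_lin_def)

context ring
begin

lemma frag_lin_cong:
  assumes "\<And>p. p \<in> Poly_Mapping.keys c \<Longrightarrow> f p = g p"
    and "\<And>p. p \<in> Poly_Mapping.keys c \<Longrightarrow> g p \<in> carrier R"
  shows "frag_lin R f c = frag_lin R g c"
  unfolding frag_lin_def
  by (rule add.finprod_cong') (use assms in \<open>auto\<close>)

lemma frag_lin_closed:
  assumes "\<And>p. p \<in> Poly_Mapping.keys c \<Longrightarrow> f p \<in> carrier R"
  shows "frag_lin R f c \<in> carrier R"
  unfolding frag_lin_def by (rule finsum_closed) (use assms in \<open>auto\<close>)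

lemma frag_lin_0 [simp]: "frag_lin R f 0 = \<zero>"
  by (simp add: frag_lin_def)

lemma frag_lin_of [simp]: "f p \<in> carrier R \<Longrightarrow> frag_lin R f (frag_of p) = f p"
  by (simp add: frag_lin_def add.int_pow_1)

text \<open>Sums over different supports become comparable once they run over a common finite set;
  the additional terms have coefficient 0.\<close>

lemma frag_lin_superset:
  assumes "finite S" "Poly_Mapping.keys c \<subseteq> S" "\<And>p. p \<in> S \<Longrightarrow> f p \<in> carrier R"
  shows "frag_lin R f c = (\<Oplus>p \<in> S. add_pow R (Poly_Mapping.lookup c p) (f p))"
  unfolding frag_lin_def
  by (rule add.finprod_mono_neutral_cong_left)
    (use assms in \<open>auto simp: in_keys_iff add_pow_int_ge\<close>)

lemma frag_lin_add:
  assumes "\<And>p. p \<in> Poly_Mapping.keys c \<union> Poly_Mapping.keys d \<Longrightarrow> f p \<in> carrier R"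
  shows "frag_lin R f (c + d) = frag_lin R f c \<oplus> frag_lin R f d"
proof -
  let ?S = "Poly_Mapping.keys c \<union> Poly_Mapping.keys d"
  have "frag_lin R f (c + d) = (\<Oplus>p \<in> ?S. add_pow R (Poly_Mapping.lookup (c + d) p) (f p))"
    using assms keys_add[of c d] by (intro frag_lin_superset) auto
  also have "\<dots> = (\<Oplus>p \<in> ?S. add_pow R (Poly_Mapping.lookup c p) (f p) \<oplus>
      add_pow R (Poly_Mapping.lookup d p) (f p))"
    by (rule add.finprod_cong') (use assms in \<open>auto simp: lookup_add add.int_pow_mult\<close>)
  also have "\<dots> = frag_lin R f c \<oplus> frag_lin R f d"
  proof -
    have "frag_lin R f b = (\<Oplus>p \<in> ?S. add_pow R (Poly_Mapping.lookup b p) (f p))"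
      if "b \<in> {c, d}" for b
      using that assms by (intro frag_lin_superset) auto
    then show ?thesis
      using assms by (simp add: finsum_addf Pi_def)
  qed
  finally show ?thesis .
qed

lemma frag_lin_minus:
  assumes "\<And>p. p \<in> Poly_Mapping.keys c \<Longrightarrow> f p \<in> carrier R"
  shows "frag_lin R f (- c) = \<ominus> frag_lin R f c"
proof -
  have "frag_lin R f (- c) \<oplus> frag_lin R f c = \<zero>"
    using assms frag_lin_add[of "- c" c f] by simp
  then show ?thesis
    using assms by (intro minus_equality[symmetric]) (auto intro!: frag_lin_closed simp: a_comm)
qed

lemma frag_lin_diff:
  assumes "\<And>p. p \<in> Poly_Mapping.keys c \<union> Poly_Mapping.keys d \<Longrightarrow> f p \<in> carrier R"
  shows "frag_lin R f (c - d) = frag_lin R f c \<ominus> frag_lin R f d"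
  using assms frag_lin_add[of c "- d" f] frag_lin_minus[of d f] by (simp add: a_minus_def)

lemma frag_lin_mem_subgroup:
  assumes "additive_subgroup H R" "\<And>p. p \<in> Poly_Mapping.keys c \<Longrightarrow> f p \<in> H"
  shows "frag_lin R f c \<in> H"
proof -
  interpret H: additive_subgroup H R by fact
  have "Poly_Mapping.keys c \<subseteq> {p. f p \<in> H}" using assms by auto
  then show ?thesis
  proof (induction c rule: free_Abelian_group_induct[consumes 1, case_names zero diff gen])
    case (diff c d)
    have "frag_lin R f (c - d) = frag_lin R f c \<ominus> frag_lin R f d"
      using diff H.a_subset by (intro frag_lin_diff) auto
    with diff show ?case
      by (simp add: a_minus_def)
  qed (use H.a_subset in auto)
qed

lemma frag_lin_fun_add:
  assumes "\<And>p. p \<in> Poly_Mapping.keys c \<Longrightarrow> f p \<in> carrier R"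
    "\<And>p. p \<in> Poly_Mapping.keys c \<Longrightarrow> g p \<in> carrier R"
  shows "frag_lin R (\<lambda>p. f p \<oplus> g p) c = frag_lin R f c \<oplus> frag_lin R g c"
proof -
  have "frag_lin R (\<lambda>p. f p \<oplus> g p) c = (\<Oplus>p \<in> Poly_Mapping.keys c.
      add_pow R (Poly_Mapping.lookup c p) (f p) \<oplus> add_pow R (Poly_Mapping.lookup c p) (g p))"
    unfolding frag_lin_def
    by (rule add.finprod_cong') (use assms in \<open>auto simp: add.int_pow_distrib\<close>)
  then show ?thesis
    unfolding frag_lin_def using assms by (simp add: finsum_addf Pi_def)
qed

lemma frag_lin_mult_left:
  assumes "a \<in> carrier R" "\<And>p. p \<in> Poly_Mapping.keys c \<Longrightarrow> f p \<in> carrier R"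
  shows "frag_lin R (\<lambda>p. a \<otimes> f p) c = a \<otimes> frag_lin R f c"
  unfolding frag_lin_def
  using assms by (subst finsum_rdistr) (auto intro!: add.finprod_cong' simp: add_pow_rdistr_int)

lemma frag_lin_mult_right:
  assumes "a \<in> carrier R" "\<And>p. p \<in> Poly_Mapping.keys c \<Longrightarrow> f p \<in> carrier R"
  shows "frag_lin R (\<lambda>p. f p \<otimes> a) c = frag_lin R f c \<otimes> a"
  unfolding frag_lin_def
  using assms by (subst finsum_ldistr) (auto intro!: add.finprod_cong' simp: add_pow_ldistr_int)

text \<open>Change of variables: a map of generators such as (x, y) -> (ax, yb) moves from the
  argument into the summand.\<close>

lemma frag_lin_extend:
  assumes "\<And>p. p \<in> Poly_Mapping.keys c \<Longrightarrow> f (g p) \<in> carrier R"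
  shows "frag_lin R f (frag_extend (\<lambda>p. frag_of (g p)) c) = frag_lin R (\<lambda>p. f (g p)) c"
proof -
  have "Poly_Mapping.keys c \<subseteq> {p. f (g p) \<in> carrier R}" using assms by auto
  then show ?thesis
  proof (induction c rule: free_Abelian_group_induct[consumes 1, case_names zero diff gen])
    case (diff c d)
    have "Poly_Mapping.keys (frag_extend (\<lambda>p. frag_of (g p)) b) \<subseteq> g ` Poly_Mapping.keys b" for b
      using keys_frag_extend[of "\<lambda>p. frag_of (g p)" b] by auto
    then show ?case
      using diff by (subst frag_extend_diff, subst (1 2) frag_lin_diff) (use diff in fastforce)+
  qed auto
qed


section \<open>Congruence modulo an additive subgroup\<close>

lemma minus_mem_trans:
  assumes "additive_subgroup H R" "a \<in> carrier R" "b \<in> carrier R" "c \<in> carrier R"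
    and "a \<ominus> b \<in> H" "b \<ominus> c \<in> H"
  shows "a \<ominus> c \<in> H"
proof -
  have "a \<ominus> c = (a \<ominus> b) \<oplus> (b \<ominus> c)"
    using assms(2,3,4) by algebra
  then show ?thesis
    using additive_subgroup.a_closed[OF assms(1,5,6)] by simp
qed

lemma minus_mem_sym:
  assumes "additive_subgroup H R" "a \<in> carrier R" "b \<in> carrier R" "a \<ominus> b \<in> H"
  shows "b \<ominus> a \<in> H"
proof -
  have "b \<ominus> a = \<ominus> (a \<ominus> b)"
    using assms(2,3) by (simp add: minus_add a_minus_def a_comm)
  then show ?thesis
    using additive_subgroup.a_inv_closed[OF assms(1,4)] by simp
qed

text \<open>Writing f = (f - g) + g splits the sum, so congruences between summands add up.\<close>

lemma frag_lin_minus_mem: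
  assumes "additive_subgroup H R"
    and "\<And>p. p \<in> Poly_Mapping.keys c \<Longrightarrow> f p \<in> carrier R"
    and "\<And>p. p \<in> Poly_Mapping.keys c \<Longrightarrow> g p \<in> carrier R"
    and "\<And>p. p \<in> Poly_Mapping.keys c \<Longrightarrow> f p \<ominus> g p \<in> H"
  shows "frag_lin R f c \<ominus> frag_lin R g c \<in> H"
proof -
  have "frag_lin R (\<lambda>p. (f p \<ominus> g p) \<oplus> g p) c = frag_lin R (\<lambda>p. f p \<ominus> g p) c \<oplus> frag_lin R g c"
    using assms by (intro frag_lin_fun_add) auto
  moreover have "frag_lin R (\<lambda>p. (f p \<ominus> g p) \<oplus> g p) c = frag_lin R f c"
  proof (rule frag_lin_cong)
    fix p assume "p \<in> Poly_Mapping.keys c"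
    then have "f p \<in> carrier R" "g p \<in> carrier R" using assms by auto
    then show "(f p \<ominus> g p) \<oplus> g p = f p" "f p \<in> carrier R"
      by (simp_all add: a_minus_def a_assoc l_neg)
  qed
  moreover have "frag_lin R (\<lambda>p. f p \<ominus> g p) c \<in> H"
    using assms by (intro frag_lin_mem_subgroup) auto
  moreover have "frag_lin R f c \<in> carrier R" "frag_lin R g c \<in> carrier R"
    "frag_lin R (\<lambda>p. f p \<ominus> g p) c \<in> carrier R"
    using assms by (auto intro!: frag_lin_closed)
  moreover from calculation
  have "frag_lin R f c = frag_lin R (\<lambda>p. f p \<ominus> g p) c \<oplus> frag_lin R g c"
    by simp
  ultimately show ?thesis
    by (simp add: a_minus_def a_assoc r_neg)
qed

section \<open>Relations of the tensor square\<close>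

lemma tensor_rels_subset:
  assumes "K \<subseteq> carrier R"
  shows "tensor_rels K R \<subseteq> carrier (free_square R)"
  unfolding tensor_rels_def using assms
  by (auto dest!: subsetD[OF keys_diff] simp: subset_iff)

lemma tensor_null_subset:
  assumes "K \<subseteq> carrier R"
  shows "tensor_null K R \<subseteq> carrier (free_square R)"
  unfolding tensor_null_def
  by (rule group.generate_incl[OF group_free_Abelian_group tensor_rels_subset[OF assms]])

text \<open>The universal property of the tensor square in asymptotic form: the family
  \<open>f s\<close> is biadditive and balanced only modulo \<open>H\<close>, and each instance only
  for \<open>s\<close> far enough along \<open>F\<close>. This suffices because an element of
  \<open>tensor_null K R\<close> is built from finitely many relations, so finitely many thresholds
  have to be combined.\<close>

lemma eventually_frag_lin_tensor_null:
  assumes H: "additive_subgroup H R"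
    and K: "K \<subseteq> carrier R"
    and f: "\<And>s p. p \<in> carrier R \<times> carrier R \<Longrightarrow> f s p \<in> carrier R"
    and add_left: "\<And>x x' y. \<lbrakk>x \<in> carrier R; x' \<in> carrier R; y \<in> carrier R\<rbrakk> \<Longrightarrow>
      \<forall>\<^sub>F s in F. f s (x \<oplus> x', y) \<ominus> f s (x, y) \<ominus> f s (x', y) \<in> H"
    and add_right: "\<And>x y y'. \<lbrakk>x \<in> carrier R; y \<in> carrier R; y' \<in> carrier R\<rbrakk> \<Longrightarrow>
      \<forall>\<^sub>F s in F. f s (x, y \<oplus> y') \<ominus> f s (x, y) \<ominus> f s (x, y') \<in> H"
    and balanced: "\<And>x k y. \<lbrakk>x \<in> carrier R; k \<in> K; y \<in> carrier R\<rbrakk> \<Longrightarrow>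
      \<forall>\<^sub>F s in F. f s (x \<otimes> k, y) \<ominus> f s (x, k \<otimes> y) \<in> H"
    and c: "c \<in> tensor_null K R"
  shows "\<forall>\<^sub>F s in F. frag_lin R (f s) c \<in> H"
proof -
  interpret H: additive_subgroup H R by fact
  note sub = tensor_rels_subset[OF K]
  have diff2: "frag_lin R (f s) (frag_of p - frag_of q) = f s p \<ominus> f s q"
    if "p \<in> carrier R \<times> carrier R" "q \<in> carrier R \<times> carrier R" for s p q
    using that f by (subst frag_lin_diff) auto
  have diff3: "frag_lin R (f s) (frag_of p - frag_of q - frag_of r) = f s p \<ominus> f s q \<ominus> f s r"
    if "p \<in> carrier R \<times> carrier R" "q \<in> carrier R \<times> carrier R" "r \<in> carrier R \<times> carrier R" for s p q r
  proof -
    have "Poly_Mapping.keys (frag_of p - frag_of q) \<subseteq> carrier R \<times> carrier R"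
      using that keys_diff[of "frag_of p" "frag_of q"] by auto
    then have "frag_lin R (f s) (frag_of p - frag_of q - frag_of r) =
        frag_lin R (f s) (frag_of p - frag_of q) \<ominus> f s r"
      using that f by (subst frag_lin_diff) auto
    then show ?thesis
      using that by (simp only: diff2)
  qed
  have rels: "\<forall>\<^sub>F s in F. frag_lin R (f s) r \<in> H" if r: "r \<in> tensor_rels K R" for r
  proof -
    from r consider
      (l) x x' y where "r = frag_of (x \<oplus> x', y) - frag_of (x, y) - frag_of (x', y)"
        "x \<in> carrier R" "x' \<in> carrier R" "y \<in> carrier R"
    | (r) x y y' where "r = frag_of (x, y \<oplus> y') - frag_of (x, y) - frag_of (x, y')"
        "x \<in> carrier R" "y \<in> carrier R" "y' \<in> carrier R"
    | (k) x k y where "r = frag_of (x \<otimes> k, y) - frag_of (x, k \<otimes> y)"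
        "x \<in> carrier R" "k \<in> K" "y \<in> carrier R"
      unfolding tensor_rels_def by blast
    then show ?thesis
    proof cases
      case l
      then show ?thesis using add_left[of x x' y] by (simp add: diff3)
    next
      case r
      then show ?thesis using add_right[of x y y'] by (simp add: diff3)
    next
      case k
      moreover have "k \<in> carrier R" using k K by blast
      ultimately show ?thesis using balanced[of x k y] by (simp add: diff2)
    qed
  qed
  have "c \<in> carrier (free_square R) \<and> (\<forall>\<^sub>F s in F. frag_lin R (f s) c \<in> H)"
    using c unfolding tensor_null_def
  proof (induction rule: generate.induct)
    case one
    then show ?case by simp
  next
    case (incl r)
    then show ?case using sub rels by blast
  next
    case (inv r)
    then have r: "r \<in> carrier (free_square R)" using sub by blast
    then have "frag_lin R (f s) (- r) = \<ominus> frag_lin R (f s) r" for s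
      using f by (intro frag_lin_minus) auto
    with rels[OF inv] r H.a_inv_closed show ?case
      by (auto elim!: eventually_mono)
  next
    case (eng c d)
    then have "frag_lin R (f s) (c + d) = frag_lin R (f s) c \<oplus> frag_lin R (f s) d" for s
      using f by (intro frag_lin_add) auto
    moreover have "\<forall>\<^sub>F s in F. frag_lin R (f s) c \<in> H \<and> frag_lin R (f s) d \<in> H"
      using eng by (simp add: eventually_conj)
    ultimately show ?case
      using eng keys_add[of c d] by (auto elim!: eventually_mono)
  qed
  then show ?thesis ..
qed

text \<open>The factors a and b are attached on the outer sides of x and y, away from
  \<open>k\<close>, so each of the three kinds of relation goes to one of the same kind.\<close>

lemma frag_act_tensor_rels:
  assumes K: "K \<subseteq> carrier R" and a: "a \<in> carrier R" and b: "b \<in> carrier R"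
    and r: "r \<in> tensor_rels K R"
  shows "frag_act R a b r \<in> tensor_rels K R"
proof -
  have act: "frag_act R a b (frag_of (x, y)) = frag_of (a \<otimes> x, y \<otimes> b)" for x y
    by (simp add: frag_act_def)
  have diff: "frag_act R a b (c - d) = frag_act R a b c - frag_act R a b d" for c d
    by (simp add: frag_act_def frag_extend_diff)
  from r consider
    (l) x x' y where "r = frag_of (x \<oplus> x', y) - frag_of (x, y) - frag_of (x', y)"
      "x \<in> carrier R" "x' \<in> carrier R" "y \<in> carrier R"
  | (r) x y y' where "r = frag_of (x, y \<oplus> y') - frag_of (x, y) - frag_of (x, y')"
      "x \<in> carrier R" "y \<in> carrier R" "y' \<in> carrier R"
  | (k) x k y where "r = frag_of (x \<otimes> k, y) - frag_of (x, k \<otimes> y)"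
      "x \<in> carrier R" "k \<in> K" "y \<in> carrier R"
    unfolding tensor_rels_def by blast
  then show ?thesis
  proof cases
    case l
    then have "frag_act R a b r = frag_of (a \<otimes> x \<oplus> a \<otimes> x', y \<otimes> b) -
        frag_of (a \<otimes> x, y \<otimes> b) - frag_of (a \<otimes> x', y \<otimes> b)"
      using a by (simp add: diff act r_distr)
    then show ?thesis
      unfolding tensor_rels_def using l a b by blast
  next
    case r
    then have "frag_act R a b r = frag_of (a \<otimes> x, y \<otimes> b \<oplus> y' \<otimes> b) -
        frag_of (a \<otimes> x, y \<otimes> b) - frag_of (a \<otimes> x, y' \<otimes> b)"
      using b by (simp add: diff act l_distr)
    then show ?thesis
      unfolding tensor_rels_def using r a b by blast
  next
    case k
    moreover have "k \<in> carrier R" using k K by blast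
    ultimately have "frag_act R a b r = frag_of ((a \<otimes> x) \<otimes> k, y \<otimes> b) - frag_of (a \<otimes> x, k \<otimes> (y \<otimes> b))"
      using a b by (simp add: diff act m_assoc)
    then show ?thesis
      unfolding tensor_rels_def using k a b by blast
  qed
qed

lemma frag_act_tensor_null:
  assumes K: "K \<subseteq> carrier R" and a: "a \<in> carrier R" and b: "b \<in> carrier R"
    and c: "c \<in> tensor_null K R"
  shows "frag_act R a b c \<in> tensor_null K R"
  using c unfolding tensor_null_def
proof (induction rule: generate.induct)
  case one
  then show ?case by (simp add: frag_act_def generate.one[of "free_square R", simplified])
next
  case (incl r)
  then show ?case by (intro generate.incl frag_act_tensor_rels[OF K a b])
next
  case (inv r)
  note rel = frag_act_tensor_rels[OF K a b inv]
  have "r \<in> carrier (free_square R)" "frag_act R a b r \<in> carrier (free_square R)"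
    using subsetD[OF tensor_rels_subset[OF K]] rel inv by blast+
  then show ?case
    using generate.inv[OF rel, of "free_square R"] by (simp add: frag_act_def frag_extend_minus)
next
  case (eng c d)
  then show ?case
    using generate.eng[OF eng.IH] by (simp add: frag_act_def frag_extend_add)
qed


section \<open>Cosets in the tensor square and the separability element\<close>

lemma tensor_null_add:
  "\<lbrakk>c \<in> tensor_null K R; d \<in> tensor_null K R\<rbrakk> \<Longrightarrow> c + d \<in> tensor_null K R"
  unfolding tensor_null_def using generate.eng by fastforce

lemma tensor_null_uminus:
  assumes "K \<subseteq> carrier R" "c \<in> tensor_null K R"
  shows "- c \<in> tensor_null K R"
  using group.generate_m_inv_closed[OF group_free_Abelian_group tensor_rels_subset[OF assms(1)]]
    assms tensor_null_subset[OF assms(1)] unfolding tensor_null_def by fastforce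

lemma tensor_null_coset:
  "tensor_null K R #>\<^bsub>free_square R\<^esub> c = (\<lambda>n. n + c) ` tensor_null K R"
  by (auto simp: r_coset_def)

lemma tensor_null_coset_memD:
  "c \<in> tensor_null K R #>\<^bsub>free_square R\<^esub> e \<Longrightarrow> c - e \<in> tensor_null K R"
  by (auto simp: tensor_null_coset)

lemma tensor_null_coset_self: "e \<in> tensor_null K R #>\<^bsub>free_square R\<^esub> e"
proof -
  have "0 \<in> tensor_null K R"
    unfolding tensor_null_def using generate.one[of "free_square R"] by simp
  then show ?thesis
    unfolding tensor_null_coset by force
qed

lemma tensor_null_coset_eq_iff:
  assumes "K \<subseteq> carrier R"
  shows "tensor_null K R #>\<^bsub>free_square R\<^esub> c = tensor_null K R #>\<^bsub>free_square R\<^esub> d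
    \<longleftrightarrow> c - d \<in> tensor_null K R"
proof
  assume "tensor_null K R #>\<^bsub>free_square R\<^esub> c = tensor_null K R #>\<^bsub>free_square R\<^esub> d"
  then show "c - d \<in> tensor_null K R"
    using tensor_null_coset_self tensor_null_coset_memD by blast
next
  have "(\<lambda>n. n + c) ` tensor_null K R \<subseteq> (\<lambda>n. n + d) ` tensor_null K R"
    if "c - d \<in> tensor_null K R" for c d
  proof
    fix x assume "x \<in> (\<lambda>n. n + c) ` tensor_null K R"
    then obtain n where n: "n \<in> tensor_null K R" "x = n + c" by blast
    then have "n + (c - d) \<in> tensor_null K R" using that by (intro tensor_null_add)
    then show "x \<in> (\<lambda>n. n + d) ` tensor_null K R" using n by force
  qed
  moreover assume "c - d \<in> tensor_null K R"
  moreover from this have "d - c \<in> tensor_null K R"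
    using tensor_null_uminus[OF assms, of "c - d"] by simp
  ultimately show "tensor_null K R #>\<^bsub>free_square R\<^esub> c = tensor_null K R #>\<^bsub>free_square R\<^esub> d"
    by (simp add: tensor_null_coset subset_antisym)
qed

text \<open>The action preserves the null subgroup, so all representatives of a coset give the same
  value and \<open>the_elem\<close> in \<open>tensor_act\<close> meets a singleton.\<close>

lemma tensor_act_coset:
  assumes K: "K \<subseteq> carrier R" and "a \<in> carrier R" "b \<in> carrier R"
  shows "tensor_act K R a b (tensor_null K R #>\<^bsub>free_square R\<^esub> e)
    = tensor_null K R #>\<^bsub>free_square R\<^esub> frag_act R a b e"
proof -
  have "tensor_null K R #>\<^bsub>free_square R\<^esub> frag_act R a b c
      = tensor_null K R #>\<^bsub>free_square R\<^esub> frag_act R a b e"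
    if "c \<in> tensor_null K R #>\<^bsub>free_square R\<^esub> e" for c
  proof -
    have "frag_act R a b (c - e) \<in> tensor_null K R"
      using assms that by (intro frag_act_tensor_null tensor_null_coset_memD)
    then show ?thesis
      by (simp add: tensor_null_coset_eq_iff[OF K] frag_act_def frag_extend_diff)
  qed
  then have "(\<lambda>c. tensor_null K R #>\<^bsub>free_square R\<^esub> frag_act R a b c) `
      (tensor_null K R #>\<^bsub>free_square R\<^esub> e)
      = {tensor_null K R #>\<^bsub>free_square R\<^esub> frag_act R a b e}"
    using tensor_null_coset_self by blast
  then show ?thesis
    unfolding tensor_act_def by (simp only: the_elem_eq)
qed

lemma additive_subgroup_zero: "additive_subgroup {\<zero>} R"
  by (rule ideal.axioms(1)[OF zeroideal])

lemma add_minus_minus_self: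
  assumes "a \<in> carrier R" "b \<in> carrier R"
  shows "a \<oplus> b \<ominus> a \<ominus> b = \<zero>"
proof -
  have "a \<oplus> b \<ominus> a = b"
    using assms by (simp add: a_minus_def a_comm[of a b] a_assoc r_neg)
  then show ?thesis
    using assms by (simp add: a_minus_def r_neg)
qed

lemma tensor_mult_coset:
  assumes K: "K \<subseteq> carrier R" and e: "e \<in> carrier (free_square R)"
  shows "tensor_mult R (tensor_null K R #>\<^bsub>free_square R\<^esub> e) = frag_mult R e"
proof -
  \<comment> \<open>A family constant in s along a nontrivial filter makes the asymptotic criterion
    exact, here for the product map and the subgroup \<open>{\<zero>}\<close>.\<close>
  have null: "frag_mult R c = \<zero>" if c: "c \<in> tensor_null K R" for c
  proof -
    have "\<forall>\<^sub>F s in (at_top :: nat filter). frag_lin R (\<lambda>p. fst p \<otimes> snd p) c \<in> {\<zero>}"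
      by (rule eventually_frag_lin_tensor_null[OF additive_subgroup_zero K _ _ _ _ c])
        (use K in \<open>auto intro!: always_eventually simp: l_distr r_distr m_assoc add_minus_minus_self subset_iff\<close>)
    then show ?thesis
      by (simp add: frag_mult_eq_frag_lin)
  qed
  have "frag_mult R c = frag_mult R e" if "c \<in> tensor_null K R #>\<^bsub>free_square R\<^esub> e" for c
  proof -
    from that obtain n where n: "n \<in> tensor_null K R" "c = n + e"
      unfolding tensor_null_coset by blast
    moreover have "frag_mult R (n + e) = frag_mult R n \<oplus> frag_mult R e"
      unfolding frag_mult_eq_frag_lin
      using e n(1) subsetD[OF tensor_null_subset[OF K]] by (intro frag_lin_add) fastforce
    moreover have "frag_mult R e \<in> carrier R"
      unfolding frag_mult_eq_frag_lin using e by (intro frag_lin_closed) fastforce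
    ultimately show ?thesis
      using null by simp
  qed
  then have "frag_mult R ` (tensor_null K R #>\<^bsub>free_square R\<^esub> e) = {frag_mult R e}"
    using tensor_null_coset_self by blast
  then show ?thesis
    unfolding tensor_mult_def by (simp only: the_elem_eq)
qed

text \<open>\<open>e\<close> is a lift of \<open>\<sigma> \<one>\<close>. Both terms of the last
  difference represent \<open>\<sigma> a\<close>, because \<open>\<sigma>\<close> respects the left
  and the right action.\<close>

lemma separability_element:
  assumes "separable_algebra K R"
  obtains e where "Poly_Mapping.keys e \<subseteq> carrier R \<times> carrier R" "frag_mult R e = \<one>"
    "\<And>a. a \<in> carrier R \<Longrightarrow> frag_act R a \<one> e - frag_act R \<one> a e \<in> tensor_null K R"
proof -
  interpret separable_algebra K R by fact
  have K: "K \<subseteq> carrier R" using base_central by (auto simp: ring_center_def)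
  obtain \<sigma> where \<sigma>: "\<sigma> \<in> hom (add_monoid R) (tensor_square K R)"
    "\<And>a x b. \<lbrakk>a \<in> carrier R; x \<in> carrier R; b \<in> carrier R\<rbrakk>
      \<Longrightarrow> \<sigma> (a \<otimes> x \<otimes> b) = tensor_act K R a b (\<sigma> x)"
    "\<And>x. x \<in> carrier R \<Longrightarrow> tensor_mult R (\<sigma> x) = x"
    using bimodule_section by blast
  have "\<sigma> \<one> \<in> carrier (tensor_square K R)"
    using \<sigma>(1) by (auto simp: hom_def)
  then obtain e where e: "e \<in> carrier (free_square R)"
    "\<sigma> \<one> = tensor_null K R #>\<^bsub>free_square R\<^esub> e"
    unfolding tensor_square_def FactGroup_def RCOSETS_def by auto
  show ?thesis
  proof
    show "Poly_Mapping.keys e \<subseteq> carrier R \<times> carrier R" using e by simp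
    show "frag_mult R e = \<one>"
      using \<sigma>(3)[of \<one>] e tensor_mult_coset[OF K e(1)] by simp
    fix a assume a: "a \<in> carrier R"
    have "tensor_null K R #>\<^bsub>free_square R\<^esub> frag_act R a \<one> e
        = tensor_null K R #>\<^bsub>free_square R\<^esub> frag_act R \<one> a e"
      using \<sigma>(2)[of a \<one> \<one>] \<sigma>(2)[of \<one> \<one> a] a
      by (simp add: e tensor_act_coset[OF K])
    then show "frag_act R a \<one> e - frag_act R \<one> a e \<in> tensor_null K R"
      by (simp add: tensor_null_coset_eq_iff[OF K])
  qed
qed


lemma ring_center_closed: "z \<in> ring_center R \<Longrightarrow> z \<in> carrier R"
  by (simp add: ring_center_def)

lemma ring_center_comm: "\<lbrakk>z \<in> ring_center R; a \<in> carrier R\<rbrakk> \<Longrightarrow> a \<otimes> z = z \<otimes> a"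
  by (simp add: ring_center_def)

lemma ring_center_lcomm:
  "\<lbrakk>z \<in> ring_center R; a \<in> carrier R; b \<in> carrier R\<rbrakk> \<Longrightarrow> a \<otimes> (z \<otimes> b) = z \<otimes> (a \<otimes> b)"
  by (metis m_assoc ring_center_closed ring_center_comm)

end

text \<open>\<open>e\<close> stays in the free group, so that explicit finite sums over its keys can
  be formed; it commutes with elements of \<open>A\<close> only modulo the tensor relations.\<close>

locale central_separable = ring A for A (structure) +
  fixes e :: "'a \<times> 'a \<Rightarrow>\<^sub>0 int"
  assumes keys_e: "Poly_Mapping.keys e \<subseteq> carrier A \<times> carrier A"
    and mult_e: "frag_mult A e = \<one>"
    and act_e: "a \<in> carrier A \<Longrightarrow>
      frag_act A a \<one> e - frag_act A \<one> a e \<in> tensor_null (ring_center A) A"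
begin

abbreviation Z where "Z \<equiv> ring_center A"

lemma Z_subset: "Z \<subseteq> carrier A"
  by (auto simp: ring_center_closed)

lemma keys_eD: "p \<in> Poly_Mapping.keys e \<Longrightarrow> fst p \<in> carrier A \<and> snd p \<in> carrier A"
  using keys_e by auto

text \<open>With e = \<Sum> x_i \<otimes> y_i this evaluates a bilinear expression on both sides of
  a e = e a: a factor in front of x_i may be moved behind y_i.\<close>

lemma eventually_separability:
  assumes H: "additive_subgroup H A"
    and f: "\<And>s x y. \<lbrakk>x \<in> carrier A; y \<in> carrier A\<rbrakk> \<Longrightarrow> f s x y \<in> carrier A"
    and add_left: "\<And>x x' y. \<lbrakk>x \<in> carrier A; x' \<in> carrier A; y \<in> carrier A\<rbrakk> \<Longrightarrow>
      \<forall>\<^sub>F s in F. f s (x \<oplus> x') y \<ominus> f s x y \<ominus> f s x' y \<in> H"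
    and add_right: "\<And>x y y'. \<lbrakk>x \<in> carrier A; y \<in> carrier A; y' \<in> carrier A\<rbrakk> \<Longrightarrow>
      \<forall>\<^sub>F s in F. f s x (y \<oplus> y') \<ominus> f s x y \<ominus> f s x y' \<in> H"
    and balanced: "\<And>x k y. \<lbrakk>x \<in> carrier A; k \<in> Z; y \<in> carrier A\<rbrakk> \<Longrightarrow>
      \<forall>\<^sub>F s in F. f s (x \<otimes> k) y \<ominus> f s x (k \<otimes> y) \<in> H"
    and a: "a \<in> carrier A"
  shows "\<forall>\<^sub>F s in F. frag_lin A (\<lambda>p. f s (a \<otimes> fst p) (snd p)) e \<ominus>
    frag_lin A (\<lambda>p. f s (fst p) (snd p \<otimes> a)) e \<in> H"
proof -
  let ?f = "\<lambda>s p. f s (fst p) (snd p)"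
  have act: "frag_lin A (?f s) (frag_act A a b e) = frag_lin A (\<lambda>p. f s (a \<otimes> fst p) (snd p \<otimes> b)) e"
    if "a \<in> carrier A" "b \<in> carrier A" for s a b
    using that keys_eD f by (simp add: frag_act_def case_prod_unfold frag_lin_extend)
  have keys_act: "Poly_Mapping.keys (frag_act A a b e) \<subseteq> carrier A \<times> carrier A"
    if "a \<in> carrier A" "b \<in> carrier A" for a b
    using that keys_eD unfolding frag_act_def
    by (intro subset_trans[OF keys_frag_extend]) (auto simp: case_prod_unfold)
  have "frag_lin A (?f s) (frag_act A a \<one> e - frag_act A \<one> a e) =
      frag_lin A (\<lambda>p. f s (a \<otimes> fst p) (snd p \<otimes> \<one>)) e \<ominus> frag_lin A (\<lambda>p. f s (\<one> \<otimes> fst p) (snd p \<otimes> a)) e" for s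
    using keys_act[of a \<one>] keys_act[of \<one> a] a f by (subst frag_lin_diff) (auto simp: act)
  moreover have "frag_lin A (\<lambda>p. f s (a \<otimes> fst p) (snd p \<otimes> \<one>)) e = frag_lin A (\<lambda>p. f s (a \<otimes> fst p) (snd p)) e"
    "frag_lin A (\<lambda>p. f s (\<one> \<otimes> fst p) (snd p \<otimes> a)) e = frag_lin A (\<lambda>p. f s (fst p) (snd p \<otimes> a)) e" for s
    using keys_eD a f by (auto intro!: frag_lin_cong)
  moreover have "\<forall>\<^sub>F s in F. frag_lin A (?f s) (frag_act A a \<one> e - frag_act A \<one> a e) \<in> H"
    by (rule eventually_frag_lin_tensor_null[OF H Z_subset _ _ _ _ act_e[OF a]])
      (use assms in auto)
  ultimately show ?thesis by simp
qed

section \<open>The retraction onto the center\<close>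

definition tr :: "'a \<Rightarrow> 'a"
  where "tr x = frag_lin A (\<lambda>p. fst p \<otimes> x \<otimes> snd p) e"

text \<open>Applying the map u \<otimes> v -> u x v to a e = e a turns a (tr x) into (tr x) a. The
  map is balanced because central k commute with x.\<close>

lemma tr_center:
  assumes x: "x \<in> carrier A"
  shows "tr x \<in> Z"
proof -
  have tr: "tr x \<in> carrier A"
    unfolding tr_def using x keys_eD by (intro frag_lin_closed) auto
  have bal: "u \<otimes> k \<otimes> x \<otimes> v \<ominus> u \<otimes> x \<otimes> (k \<otimes> v) \<in> {\<zero>}"
    if "u \<in> carrier A" "k \<in> Z" "v \<in> carrier A" for u k v
    using that x by (simp add: m_assoc ring_center_closed ring_center_lcomm[of k])
  have "tr x \<otimes> a = a \<otimes> tr x" if a: "a \<in> carrier A" for a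
  proof -
    have "\<forall>\<^sub>F s in (at_top :: nat filter). frag_lin A (\<lambda>p. (a \<otimes> fst p) \<otimes> x \<otimes> snd p) e \<ominus>
        frag_lin A (\<lambda>p. fst p \<otimes> x \<otimes> (snd p \<otimes> a)) e \<in> {\<zero>}"
      by (rule eventually_separability[OF additive_subgroup_zero])
        (use a x bal in \<open>auto intro!: always_eventually simp: l_distr r_distr add_minus_minus_self\<close>)
    moreover have "frag_lin A (\<lambda>p. (a \<otimes> fst p) \<otimes> x \<otimes> snd p) e = a \<otimes> tr x"
      unfolding tr_def using a x keys_eD
      by (subst frag_lin_mult_left[symmetric]) (auto intro!: frag_lin_cong simp: m_assoc)
    moreover have "frag_lin A (\<lambda>p. fst p \<otimes> x \<otimes> (snd p \<otimes> a)) e = tr x \<otimes> a"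
      unfolding tr_def using a x keys_eD
      by (subst frag_lin_mult_right[symmetric]) (auto intro!: frag_lin_cong simp: m_assoc)
    ultimately show ?thesis
      using tr a by (simp add: r_right_minus_eq)
  qed
  with tr show ?thesis by (simp add: ring_center_def)
qed

lemma tr_add:
  assumes "x \<in> carrier A" "y \<in> carrier A"
  shows "tr (x \<oplus> y) = tr x \<oplus> tr y"
  unfolding tr_def using assms keys_eD
  by (subst frag_lin_fun_add[symmetric]) (auto intro!: frag_lin_cong simp: l_distr r_distr)

lemma tr_mult_center:
  assumes "z \<in> Z" "x \<in> carrier A"
  shows "tr (z \<otimes> x) = z \<otimes> tr x"
  unfolding tr_def using assms keys_eD ring_center_closed
  by (subst frag_lin_mult_left[symmetric])
    (auto intro!: frag_lin_cong simp: m_assoc ring_center_lcomm[OF assms(1)])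

lemma tr_one: "tr \<one> = \<one>"
proof -
  have "tr \<one> = frag_mult A e"
    unfolding tr_def frag_mult_eq_frag_lin using keys_eD by (intro frag_lin_cong) auto
  then show ?thesis by (simp add: mult_e)
qed

lemma tr_of_center: "z \<in> Z \<Longrightarrow> tr z = z"
  using tr_mult_center[of z \<one>] by (simp add: tr_one ring_center_closed)

lemma tr_mem_ideal:
  assumes "ideal J A" "x \<in> J"
  shows "tr x \<in> J"
  unfolding tr_def using assms keys_eD
  by (intro frag_lin_mem_subgroup) (auto simp: ideal.I_l_closed ideal.I_r_closed ideal.axioms(1))

lemma tr_zero: "tr \<zero> = \<zero>"
  using tr_mem_ideal[OF zeroideal] by simp

lemma tr_uminus:
  assumes "x \<in> carrier A"
  shows "tr (\<ominus> x) = \<ominus> tr x"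
proof -
  have "tr (\<ominus> x) \<oplus> tr x = \<zero>"
    using assms tr_add[of "\<ominus> x" x] by (simp add: l_neg tr_zero)
  then show ?thesis
    using assms tr_center ring_center_closed by (intro minus_equality[symmetric]) (auto simp: a_comm)
qed

end

section \<open>Ideals of a ring and of its center\<close>

context ring
begin


text \<open>Negatives are phrased as multiples by \<open>\<ominus> \<one>\<close>, so that closure
  under scalars supplies them, both for one-sided ideals and for submodules over the center.\<close>

lemma additive_subgroup_if_closed:
  assumes "I \<subseteq> carrier R" "\<zero> \<in> I" "\<And>x y. \<lbrakk>x \<in> I; y \<in> I\<rbrakk> \<Longrightarrow> x \<oplus> y \<in> I"
    and "\<And>x. x \<in> I \<Longrightarrow> \<ominus> \<one> \<otimes> x \<in> I"
  shows "additive_subgroup I R"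
proof (rule additive_subgroupI, rule add.subgroupI)
  fix x assume x: "x \<in> I"
  then have "\<ominus> x = \<ominus> \<one> \<otimes> x" using assms(1) by (auto simp: l_minus)
  then show "\<ominus> x \<in> I" using assms(4)[OF x] by simp
qed (use assms in auto)

lemma left_idealI:
  assumes "I \<subseteq> carrier R" "\<zero> \<in> I" "\<And>x y. \<lbrakk>x \<in> I; y \<in> I\<rbrakk> \<Longrightarrow> x \<oplus> y \<in> I"
    and "\<And>a x. \<lbrakk>a \<in> carrier R; x \<in> I\<rbrakk> \<Longrightarrow> a \<otimes> x \<in> I"
  shows "left_ideal I R"
  using assms by (intro left_ideal.intro left_ideal_axioms.intro additive_subgroup_if_closed ring_axioms) auto

lemma two_sided_idealI:
  assumes "I \<subseteq> carrier R" "\<zero> \<in> I" "\<And>x y. \<lbrakk>x \<in> I; y \<in> I\<rbrakk> \<Longrightarrow> x \<oplus> y \<in> I"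
    and "\<And>a x. \<lbrakk>a \<in> carrier R; x \<in> I\<rbrakk> \<Longrightarrow> a \<otimes> x \<in> I"
    and "\<And>a x. \<lbrakk>a \<in> carrier R; x \<in> I\<rbrakk> \<Longrightarrow> x \<otimes> a \<in> I"
  shows "ideal I R"
  using assms by (intro ideal.intro ideal_axioms.intro additive_subgroup_if_closed ring_axioms) auto

lemma ideal_imp_left_ideal: "ideal I R \<Longrightarrow> left_ideal I R"
  by (intro left_ideal.intro left_ideal_axioms.intro ring_axioms)
    (auto simp: ideal.axioms(1) ideal.I_l_closed)

lemma ring_center_zero: "\<zero> \<in> ring_center R"
  and ring_center_one: "\<one> \<in> ring_center R"
  and ring_center_add: "\<lbrakk>x \<in> ring_center R; y \<in> ring_center R\<rbrakk> \<Longrightarrow> x \<oplus> y \<in> ring_center R"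
  and ring_center_mult: "\<lbrakk>x \<in> ring_center R; y \<in> ring_center R\<rbrakk> \<Longrightarrow> x \<otimes> y \<in> ring_center R"
  and ring_center_uminus: "x \<in> ring_center R \<Longrightarrow> \<ominus> x \<in> ring_center R"
  using subringE[OF ring_center_subring] by auto

lemma ring_center_cring: "cring (R\<lparr>carrier := ring_center R\<rparr>)"
proof (rule cringI)
  note Z = subring_is_ring[OF ring_center_subring]
  show "abelian_group (R\<lparr>carrier := ring_center R\<rparr>)"
    by (rule ring.is_abelian_group[OF Z])
  show "comm_monoid (R\<lparr>carrier := ring_center R\<rparr>)"
    using ring_center_comm ring_center_closed
    by (intro monoid.monoid_comm_monoidI[OF ring.is_monoid[OF Z]]) auto
qed (use ring_center_closed in \<open>auto simp: l_distr\<close>)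

lemma center_idealI:
  assumes "P \<subseteq> ring_center R" "\<zero> \<in> P" "\<And>x y. \<lbrakk>x \<in> P; y \<in> P\<rbrakk> \<Longrightarrow> x \<oplus> y \<in> P"
    and "\<And>a x. \<lbrakk>a \<in> ring_center R; x \<in> P\<rbrakk> \<Longrightarrow> a \<otimes> x \<in> P"
  shows "ideal P (R\<lparr>carrier := ring_center R\<rparr>)"
proof -
  note Z = cring.axioms(1)[OF ring_center_cring]
  have comm: "x \<otimes> a = a \<otimes> x" if "x \<in> P" "a \<in> ring_center R" for a x
    using that assms(1) ring_center_closed ring_center_comm by blast
  show ?thesis
    by (rule ring.two_sided_idealI[OF Z]) (use assms comm in auto)
qed

lemma center_idealD:
  assumes "ideal P (R\<lparr>carrier := ring_center R\<rparr>)"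
  shows "P \<subseteq> ring_center R" "\<zero> \<in> P" "\<And>x y. \<lbrakk>x \<in> P; y \<in> P\<rbrakk> \<Longrightarrow> x \<oplus> y \<in> P"
    "\<And>a x. \<lbrakk>a \<in> ring_center R; x \<in> P\<rbrakk> \<Longrightarrow> a \<otimes> x \<in> P"
  using additive_subgroup.a_subset[OF ideal.axioms(1)[OF assms]]
    additive_subgroup.zero_closed[OF ideal.axioms(1)[OF assms]]
    additive_subgroup.a_closed[OF ideal.axioms(1)[OF assms]] ideal.I_l_closed[OF assms]
  by auto

end

context central_separable
begin


text \<open>The elements all of whose two-sided multiples have trace in \<open>P\<close> form an
  ideal, which contains \<open>P\<close> because b c b' = c (b b') for central c. As the retraction
  fixes central elements, the extension of \<open>P\<close> to \<open>A\<close> contracts back to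
  \<open>P\<close>.\<close>

lemma tr_genideal:
  assumes P: "ideal P (A\<lparr>carrier := Z\<rparr>)" and "x \<in> Idl P"
  shows "tr x \<in> P"
proof -
  note P_subset = center_idealD(1)[OF P] and P_zero = center_idealD(2)[OF P]
    and P_add = center_idealD(3)[OF P] and P_mult = center_idealD(4)[OF P]
  let ?T = "{x \<in> carrier A. \<forall>b \<in> carrier A. \<forall>b' \<in> carrier A. tr (b \<otimes> x \<otimes> b') \<in> P}"
  have "ideal ?T A"
  proof (rule two_sided_idealI)
    show "\<zero> \<in> ?T" using P_zero by (simp add: tr_zero)
  next
    fix x y assume "x \<in> ?T" "y \<in> ?T"
    then show "x \<oplus> y \<in> ?T"
      by (auto simp: r_distr l_distr tr_add P_add)
  next
    fix a x assume "a \<in> carrier A" "x \<in> ?T"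
    then show "a \<otimes> x \<in> ?T" "x \<otimes> a \<in> ?T"
      by (auto simp: m_assoc[symmetric]) (simp add: m_assoc)
  qed auto
  moreover have "P \<subseteq> ?T"
  proof
    fix c assume c: "c \<in> P"
    then have cZ: "c \<in> Z" using P_subset by auto
    have "tr (b \<otimes> c \<otimes> b') \<in> P" if b: "b \<in> carrier A" "b' \<in> carrier A" for b b'
    proof -
      have "b \<otimes> c \<otimes> b' = c \<otimes> (b \<otimes> b')"
        using b cZ ring_center_closed by (simp add: m_assoc ring_center_lcomm[of c])
      then have "tr (b \<otimes> c \<otimes> b') = tr (b \<otimes> b') \<otimes> c"
        using b cZ tr_center ring_center_closed ring_center_comm[OF cZ] by (simp add: tr_mult_center)
      then show ?thesis using P_mult[OF tr_center c] b by simp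
    qed
    then show "c \<in> ?T" using cZ ring_center_closed by auto
  qed
  ultimately have "Idl P \<subseteq> ?T" by (rule genideal_minimal)
  with assms(2) have "x \<in> carrier A" "tr (\<one> \<otimes> x \<otimes> \<one>) \<in> P" by auto
  then show "tr x \<in> P" by simp
qed

end

section \<open>Left ideals over the residue field of a prime of the center\<close>

locale central_separable_prime = central_separable +
  fixes P
  assumes prime: "primeideal P (A\<lparr>carrier := ring_center A\<rparr>)"
begin

lemma P_ideal: "ideal P (A\<lparr>carrier := Z\<rparr>)"
  using prime by (simp add: primeideal_def)

lemmas P_subset = center_idealD(1)[OF P_ideal]
lemmas P_zero = center_idealD(2)[OF P_ideal]
lemmas P_add = center_idealD(3)[OF P_ideal]
lemmas P_mult = center_idealD(4)[OF P_ideal]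

lemma P_primeD: "\<lbrakk>x \<in> Z; y \<in> Z; x \<otimes> y \<in> P\<rbrakk> \<Longrightarrow> x \<in> P \<or> y \<in> P"
  using primeideal.I_prime[OF prime] by simp

lemma one_notin_P: "\<one> \<notin> P"
proof
  assume "\<one> \<in> P"
  then have "Z \<subseteq> P"
    using P_mult[of _ \<one>] ring_center_closed by fastforce
  then show False
    using P_subset primeideal.I_notcarr[OF prime] by auto
qed

abbreviation S where "S \<equiv> Z - P"

lemma S_one: "\<one> \<in> S"
  by (simp add: one_notin_P ring_center_one)

lemma S_mult: "\<lbrakk>s \<in> S; t \<in> S\<rbrakk> \<Longrightarrow> s \<otimes> t \<in> S"
  using P_primeD ring_center_mult by blast

text \<open>The kernel of \<open>A \<rightarrow> A \<otimes>\<^sub>Z Frac (Z/P)\<close>.\<close>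

definition Q :: "'a set"
  where "Q = {x \<in> carrier A. \<exists>s \<in> S. s \<otimes> x \<in> Idl P}"

lemma P_subset_carrier: "P \<subseteq> carrier A"
  using P_subset Z_subset by blast

lemma Idl_P: "ideal (Idl P) A" "P \<subseteq> Idl P"
  using P_subset_carrier by (auto intro: genideal_ideal genideal_self[THEN subsetD])

lemma Q_ideal: "ideal Q A"
proof -
  interpret I: ideal "Idl P" A by (rule Idl_P)
  show ?thesis
  proof (rule two_sided_idealI)
    show "Q \<subseteq> carrier A" "\<zero> \<in> Q"
      using S_one by (auto simp: Q_def intro!: bexI[of _ \<one>])
  next
    fix x y assume "x \<in> Q" "y \<in> Q"
    then obtain s t where st: "s \<in> S" "t \<in> S" "s \<otimes> x \<in> Idl P" "t \<otimes> y \<in> Idl P"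
      and xy: "x \<in> carrier A" "y \<in> carrier A"
      by (auto simp: Q_def)
    have c: "s \<in> carrier A" "t \<in> carrier A" using st ring_center_closed by auto
    have "(s \<otimes> t) \<otimes> (x \<oplus> y) = t \<otimes> (s \<otimes> x) \<oplus> s \<otimes> (t \<otimes> y)"
      using st xy c by (simp add: r_distr m_assoc ring_center_lcomm[of t])
    also have "\<dots> \<in> Idl P"
      using st c by (simp add: I.I_l_closed)
    finally show "x \<oplus> y \<in> Q"
      using S_mult[OF st(1,2)] xy unfolding Q_def by blast
  next
    fix a x assume a: "a \<in> carrier A" and "x \<in> Q"
    then obtain s where s: "s \<in> S" "s \<otimes> x \<in> Idl P" and x: "x \<in> carrier A"
      by (auto simp: Q_def)
    have sc: "s \<in> carrier A" using s ring_center_closed by auto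
    have "s \<otimes> (a \<otimes> x) = a \<otimes> (s \<otimes> x)" "s \<otimes> (x \<otimes> a) = (s \<otimes> x) \<otimes> a"
      using s x a sc by (simp_all add: m_assoc ring_center_lcomm[of s])
    then have "s \<otimes> (a \<otimes> x) \<in> Idl P" "s \<otimes> (x \<otimes> a) \<in> Idl P"
      using s a I.I_l_closed I.I_r_closed by auto
    then show "a \<otimes> x \<in> Q" "x \<otimes> a \<in> Q"
      using s x a unfolding Q_def by blast+
  qed
qed

lemma Idl_P_subset_Q: "Idl P \<subseteq> Q"
proof
  fix x assume x: "x \<in> Idl P"
  then have "x \<in> carrier A" using ideal.Icarr[OF Idl_P(1)] by blast
  with x S_one show "x \<in> Q" by (auto simp: Q_def intro!: bexI[of _ \<one>])
qed

lemma Q_saturated: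
  assumes "s \<in> S" "x \<in> carrier A" "s \<otimes> x \<in> Q"
  shows "x \<in> Q"
proof -
  obtain t where t: "t \<in> S" "t \<otimes> (s \<otimes> x) \<in> Idl P"
    using assms by (auto simp: Q_def)
  then have "(t \<otimes> s) \<otimes> x \<in> Idl P"
    using assms ring_center_closed by (simp add: m_assoc)
  then show ?thesis
    using S_mult[OF t(1) assms(1)] assms(2) unfolding Q_def by blast
qed

text \<open>Since s (tr x) = tr (s x) lies in P, primality cancels the denominator s.\<close>

lemma tr_Q:
  assumes "x \<in> Q"
  shows "tr x \<in> P"
proof -
  obtain s where s: "s \<in> S" "s \<otimes> x \<in> Idl P" and x: "x \<in> carrier A"
    using assms by (auto simp: Q_def)
  then have "s \<otimes> tr x \<in> P"
    using tr_genideal[OF P_ideal s(2)] tr_mult_center[of s x] by simp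
  then show ?thesis
    using P_primeD[of s "tr x"] s tr_center[OF x] by blast
qed

text \<open>A central element of Q equals its own trace, hence lies in P; so Z/P embeds into
  A/Q.\<close>

lemma Q_Int_Z: "Q \<inter> Z = P"
  using tr_Q tr_of_center P_subset Idl_P(2) Idl_P_subset_Q by force


section \<open>Averaging a projection with denominators\<close>

text \<open>Instead of inverting \<open>S\<close>, fractions are replaced by germs along \<open>S\<close> directed by divisibility:
  an element with denominator \<open>s\<close> becomes a function of \<open>t \<in> S\<close> that is meaningful on the multiples
  of \<open>s\<close>.\<close>

definition S_filter :: "'a filter"
  where "S_filter = (INF s \<in> S. principal ((\<lambda>t. t \<otimes> s) ` S))"

lemma S_comm: "\<lbrakk>s \<in> S; t \<in> S\<rbrakk> \<Longrightarrow> s \<otimes> t = t \<otimes> s"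
  using ring_center_comm ring_center_closed by blast

lemma S_closed: "s \<in> S \<Longrightarrow> s \<in> carrier A"
  using ring_center_closed by blast

text \<open>Two denominators have their product as a common multiple, so the sets of multiples form
  a filter base.\<close>

lemma eventually_S_filter:
  "eventually R S_filter \<longleftrightarrow> (\<exists>s \<in> S. \<forall>t \<in> S. R (t \<otimes> s))"
  unfolding S_filter_def
proof (subst eventually_INF_base)
  show "S \<noteq> {}" using S_one by blast
  fix s t assume st: "s \<in> S" "t \<in> S"
  have "u \<otimes> (s \<otimes> t) \<in> (\<lambda>u. u \<otimes> s) ` S \<inter> (\<lambda>u. u \<otimes> t) ` S" if u: "u \<in> S" for u
  proof -
    have "u \<otimes> (s \<otimes> t) = (u \<otimes> s) \<otimes> t" "u \<otimes> (s \<otimes> t) = (u \<otimes> t) \<otimes> s"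
      using u st S_closed by (simp_all add: m_assoc S_comm[OF st])
    then show ?thesis
      using S_mult[OF u st(1)] S_mult[OF u st(2)] by blast
  qed
  then have "(\<lambda>u. u \<otimes> (s \<otimes> t)) ` S \<subseteq> (\<lambda>u. u \<otimes> s) ` S \<inter> (\<lambda>u. u \<otimes> t) ` S"
    by blast
  then show "\<exists>x\<in>S. principal ((\<lambda>u. u \<otimes> x) ` S)
      \<le> inf (principal ((\<lambda>u. u \<otimes> s) ` S)) (principal ((\<lambda>u. u \<otimes> t) ` S))"
    using S_mult[OF st] by (intro bexI[of _ "s \<otimes> t"]) (auto simp: inf_principal)
qed (simp add: eventually_principal)

lemma Q_additive: "additive_subgroup Q A"
  by (rule ideal.axioms(1)[OF Q_ideal])

lemma P_mult_Q: "\<lbrakk>c \<in> P; x \<in> carrier A\<rbrakk> \<Longrightarrow> c \<otimes> x \<in> Q"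
  using Idl_P(2) Idl_P_subset_Q ideal.I_r_closed[OF Q_ideal] by blast

text \<open>Over the fraction field, \<open>W\<close> becomes a vector space complement of \<open>I\<close>.\<close>

lemma exists_complement:
  assumes I: "left_ideal I A"
  obtains W where "W \<subseteq> carrier A" "Q \<subseteq> W" "\<And>x y. \<lbrakk>x \<in> W; y \<in> W\<rbrakk> \<Longrightarrow> x \<oplus> y \<in> W"
    "\<And>z x. \<lbrakk>z \<in> Z; x \<in> W\<rbrakk> \<Longrightarrow> z \<otimes> x \<in> W" "W \<inter> I \<subseteq> Q"
    "\<And>x. x \<in> carrier A \<Longrightarrow> \<exists>s \<in> S. \<exists>k \<in> I. s \<otimes> x \<ominus> k \<in> W"
proof -
  interpret I: left_ideal I A by fact
  interpret Q: ideal Q A by (rule Q_ideal)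
  \<comment> \<open>Over the fraction field these submodules become the subspaces independent of I;
    a maximal one is a complement.\<close>
  define Ws where "Ws = {W. W \<subseteq> carrier A \<and> Q \<subseteq> W \<and> (\<forall>x \<in> W. \<forall>y \<in> W. x \<oplus> y \<in> W) \<and>
    (\<forall>z \<in> Z. \<forall>x \<in> W. z \<otimes> x \<in> W) \<and> W \<inter> I \<subseteq> Q}"
  have "\<exists>W \<in> Ws. (\<forall>V \<in> Ws. W \<subseteq> V \<longrightarrow> V = W)"
  proof (rule subset_Zorn_nonempty)
    show "Ws \<noteq> {}"
      using Q.I_l_closed ring_center_closed unfolding Ws_def by (auto intro!: exI[of _ Q])
    fix \<C> assume C: "\<C> \<noteq> {}" "subset.chain Ws \<C>"
    then have mem: "W \<subseteq> carrier A" "Q \<subseteq> W" "\<And>x y. \<lbrakk>x \<in> W; y \<in> W\<rbrakk> \<Longrightarrow> x \<oplus> y \<in> W"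
      "\<And>z x. \<lbrakk>z \<in> Z; x \<in> W\<rbrakk> \<Longrightarrow> z \<otimes> x \<in> W" "W \<inter> I \<subseteq> Q" if "W \<in> \<C>" for W
      using that unfolding subset_chain_def Ws_def by auto
    have "x \<oplus> y \<in> \<Union>\<C>" if xy: "x \<in> \<Union>\<C>" "y \<in> \<Union>\<C>" for x y
    proof -
      obtain V Y where XY: "x \<in> V" "V \<in> \<C>" "y \<in> Y" "Y \<in> \<C>" using xy by blast
      then have "V \<subseteq> Y \<or> Y \<subseteq> V" using C(2) unfolding subset_chain_def by blast
      then show ?thesis using XY mem(3) by blast
    qed
    moreover have "\<Union>\<C> \<subseteq> carrier A" "\<Union>\<C> \<inter> I \<subseteq> Q" using mem(1,5) by blast+
    moreover have "Q \<subseteq> \<Union>\<C>" using C(1) mem(2) by blast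
    moreover have "z \<otimes> x \<in> \<Union>\<C>" if "z \<in> Z" "x \<in> \<Union>\<C>" for z x using that mem(4) by blast
    ultimately show "\<Union>\<C> \<in> Ws"
      unfolding Ws_def by simp
  qed
  then obtain W where W: "W \<in> Ws" and max: "\<And>V. \<lbrakk>V \<in> Ws; W \<subseteq> V\<rbrakk> \<Longrightarrow> V = W" by blast
  then have W1: "W \<subseteq> carrier A" and W2: "Q \<subseteq> W" and W3: "\<And>x y. \<lbrakk>x \<in> W; y \<in> W\<rbrakk> \<Longrightarrow> x \<oplus> y \<in> W"
    and W4: "\<And>z x. \<lbrakk>z \<in> Z; x \<in> W\<rbrakk> \<Longrightarrow> z \<otimes> x \<in> W" and W5: "W \<inter> I \<subseteq> Q"
    unfolding Ws_def by auto
  have W6: "\<exists>s \<in> S. \<exists>k \<in> I. s \<otimes> x \<ominus> k \<in> W" if x: "x \<in> carrier A" for x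
  proof (cases "x \<in> W")
    case True
    then show ?thesis
      using S_one x by (intro bexI[of _ \<one>] bexI[of _ \<zero>]) (auto simp: a_minus_def)
  next
    case False
    \<comment> \<open>Adjoining x to the maximal W must produce an element w + r x of I outside Q.
      Then r is a denominator for x, with I-component w + r x and remainder -w in W.\<close>
    define V where "V = {w \<oplus> r \<otimes> x | w r. w \<in> W \<and> r \<in> Z}"
    have WX: "W \<subseteq> V"
    proof
      fix w assume "w \<in> W"
      then have "w = w \<oplus> \<zero> \<otimes> x" using W1 x by auto
      with \<open>w \<in> W\<close> show "w \<in> V" unfolding V_def using ring_center_zero by blast
    qed
    have "x = \<zero> \<oplus> \<one> \<otimes> x" using x by simp
    then have "x \<in> V"
      unfolding V_def using ring_center_one W2 Q.zero_closed by blast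
    then have "V \<notin> Ws" using max[OF _ WX] False by blast
    moreover have "V \<subseteq> carrier A" using W1 x ring_center_closed unfolding V_def by blast
    moreover have "y \<oplus> y' \<in> V" if "y \<in> V" "y' \<in> V" for y y'
    proof -
      from that obtain w r w' r' where *: "y = w \<oplus> r \<otimes> x" "y' = w' \<oplus> r' \<otimes> x" "w \<in> W" "w' \<in> W" "r \<in> Z" "r' \<in> Z"
        unfolding V_def by blast
      then have c: "w \<in> carrier A" "w' \<in> carrier A" "r \<in> carrier A" "r' \<in> carrier A"
        using W1 ring_center_closed by auto
      have "y \<oplus> y' = (w \<oplus> w') \<oplus> (r \<oplus> r') \<otimes> x"
        using c x by (simp add: *(1,2) l_distr a_ac)
      then show ?thesis
        unfolding V_def using W3 ring_center_add * by blast
    qed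
    moreover have "z \<otimes> y \<in> V" if "z \<in> Z" "y \<in> V" for z y
    proof -
      from that obtain w r where *: "y = w \<oplus> r \<otimes> x" "w \<in> W" "r \<in> Z"
        unfolding V_def by blast
      then have c: "w \<in> carrier A" "r \<in> carrier A" "z \<in> carrier A"
        using W1 ring_center_closed that by auto
      have "z \<otimes> y = z \<otimes> w \<oplus> (z \<otimes> r) \<otimes> x"
        using c x by (simp add: *(1) r_distr m_assoc)
      then show ?thesis
        unfolding V_def using W4 ring_center_mult * that by blast
    qed
    ultimately have "\<not> V \<inter> I \<subseteq> Q"
      using subset_trans[OF W2 WX] unfolding Ws_def by simp
    then obtain w r where wr: "w \<in> W" "r \<in> Z" "w \<oplus> r \<otimes> x \<in> I" "w \<oplus> r \<otimes> x \<notin> Q"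
      unfolding V_def by blast
    then have c: "w \<in> carrier A" "r \<in> carrier A" using W1 ring_center_closed by auto
    \<comment> \<open>For r in P the term r x lies in Q, so w + r x would be an element of both W
      and I outside Q.\<close>
    have "r \<notin> P"
    proof
      assume "r \<in> P"
      then have "w \<oplus> r \<otimes> x \<in> W" using W3 wr(1) W2 P_mult_Q[OF _ x] by blast
      then show False using wr W5 by blast
    qed
    have "r \<otimes> x \<ominus> (w \<oplus> r \<otimes> x) = \<ominus> w"
      using c x by (simp add: a_minus_def minus_add a_lcomm[of "r \<otimes> x"] r_neg)
    also have "\<dots> = \<ominus> \<one> \<otimes> w"
      using c by (simp add: l_minus)
    finally have "r \<otimes> x \<ominus> (w \<oplus> r \<otimes> x) \<in> W"
      using W4[OF ring_center_uminus[OF ring_center_one] wr(1)] by simp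
    then show ?thesis using wr \<open>r \<notin> P\<close> by blast
  qed
  show ?thesis
    by (rule that[OF W1 W2 W3 W4 W5 W6])
qed


text \<open>The element i/d is a right identity of I over the fraction field. With the projection
  \<pi> onto I along W and e = \<Sum> x_i \<otimes> y_i, put E = \<Sum> x_i \<pi>(y_i). For x in I
  one has x E = \<Sum> x_i \<pi>(y_i x) = \<Sum> x_i y_i x = x, first by x e = e x and then because
  y_i x lies in I. The proof does this with denominators cleared and modulo Q.\<close>

lemma left_ideal_mod_idempotent:
  assumes I: "left_ideal I A"
  obtains i d where "i \<in> I" "d \<in> S" "\<And>x. x \<in> I \<Longrightarrow> x \<otimes> i \<ominus> d \<otimes> x \<in> Q"
proof -
  interpret I: left_ideal I A by fact
  interpret Q: ideal Q A by (rule Q_ideal)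
  obtain W where W: "W \<subseteq> carrier A" "Q \<subseteq> W" "\<And>x y. \<lbrakk>x \<in> W; y \<in> W\<rbrakk> \<Longrightarrow> x \<oplus> y \<in> W"
    "\<And>z x. \<lbrakk>z \<in> Z; x \<in> W\<rbrakk> \<Longrightarrow> z \<otimes> x \<in> W" "W \<inter> I \<subseteq> Q"
    "\<And>x. x \<in> carrier A \<Longrightarrow> \<exists>s \<in> S. \<exists>k \<in> I. s \<otimes> x \<ominus> k \<in> W"
    by (rule exists_complement[OF I]) blast
  interpret W: additive_subgroup W A
    using W(1,3) W(4)[OF ring_center_uminus[OF ring_center_one]] Q.zero_closed W(2)
    by (intro additive_subgroup_if_closed) auto
  have I_carrier: "k \<in> I \<Longrightarrow> k \<in> carrier A" for k by simp
  \<comment> \<open>\<open>U\<close> consists of the elements that decompose along I and W without a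
    denominator. The default 0 of \<open>\<pi>\<close> outside \<open>U\<close> keeps all its values
    in \<open>I\<close>.\<close>
  define U where "U = {y \<in> carrier A. \<exists>k \<in> I. y \<ominus> k \<in> W}"
  define \<pi> where "\<pi> y = (if y \<in> U then SOME k. k \<in> I \<and> y \<ominus> k \<in> W else \<zero>)" for y
  have \<pi>U: "\<pi> y \<in> I \<and> y \<ominus> \<pi> y \<in> W" if "y \<in> U" for y
    using that someI_ex[of "\<lambda>k. k \<in> I \<and> y \<ominus> k \<in> W"] unfolding \<pi>_def U_def by auto
  then have \<pi>I: "\<pi> y \<in> I" for y
    by (cases "y \<in> U") (auto simp: \<pi>_def)
  have \<pi>c: "\<pi> y \<in> carrier A" for y using \<pi>I by simp
  have UI: "y \<in> U" if "y \<in> carrier A" "k \<in> I" "y \<ominus> k \<in> W" for y k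
    using that unfolding U_def by blast
  \<comment> \<open>Two choices of the I-component differ by an element of both W and I, hence of Q;
    this makes \<open>\<pi>\<close> additive and Z-linear modulo Q on \<open>U\<close>.\<close>
  have uniq: "\<pi> y \<ominus> k \<in> Q" if y: "y \<in> carrier A" "k \<in> I" "y \<ominus> k \<in> W" for y k
  proof -
    have "y \<in> U" using UI[OF y] .
    have "\<pi> y \<ominus> y \<in> W"
      by (rule minus_mem_sym[OF W.is_additive_subgroup]) (use \<pi>U \<pi>c y \<open>y \<in> U\<close> in auto)
    note * = this
    have "\<pi> y \<ominus> k \<in> W"
      by (rule minus_mem_trans[OF W.is_additive_subgroup, of "\<pi> y" y k]) (use * y \<pi>c in auto)
    moreover have "\<pi> y \<ominus> k \<in> I" using \<pi>I y by (simp add: a_minus_def)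
    ultimately show ?thesis using W(5) by blast
  qed
  have \<pi>_of_I: "\<pi> k \<ominus> k \<in> Q" if "k \<in> I" for k
    using that by (intro uniq) (auto simp: a_minus_def r_neg)
  have \<pi>_add: "\<pi> (y \<oplus> y') \<ominus> (\<pi> y \<oplus> \<pi> y') \<in> Q" if y: "y \<in> U" "y' \<in> U" for y y'
  proof (rule uniq)
    have c: "y \<in> carrier A" "y' \<in> carrier A" using y by (auto simp: U_def)
    then show "y \<oplus> y' \<in> carrier A" by simp
    show "\<pi> y \<oplus> \<pi> y' \<in> I" using \<pi>I by simp
    have "(y \<oplus> y') \<ominus> (\<pi> y \<oplus> \<pi> y') = (y \<ominus> \<pi> y) \<oplus> (y' \<ominus> \<pi> y')"
      using c \<pi>c by (simp add: a_minus_def minus_add a_ac)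
    then show "(y \<oplus> y') \<ominus> (\<pi> y \<oplus> \<pi> y') \<in> W" using \<pi>U y by simp
  qed
  have U_mult: "z \<otimes> y \<in> carrier A" "z \<otimes> \<pi> y \<in> I" "z \<otimes> y \<ominus> z \<otimes> \<pi> y \<in> W"
    if y: "z \<in> Z" "y \<in> U" for z y
  proof -
    have c: "y \<in> carrier A" "z \<in> carrier A" using y ring_center_closed by (auto simp: U_def)
    then show "z \<otimes> y \<in> carrier A" by simp
    show "z \<otimes> \<pi> y \<in> I" using \<pi>I c I.l_closed by blast
    have "z \<otimes> y \<ominus> z \<otimes> \<pi> y = z \<otimes> (y \<ominus> \<pi> y)"
      using c \<pi>c by (simp add: a_minus_def r_distr r_minus)
    then show "z \<otimes> y \<ominus> z \<otimes> \<pi> y \<in> W" using W(4)[OF y(1)] \<pi>U[OF y(2)] by simp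
  qed
  have \<pi>_mult: "\<pi> (z \<otimes> y) \<ominus> z \<otimes> \<pi> y \<in> Q" if "z \<in> Z" "y \<in> U" for z y
    by (rule uniq[OF U_mult[OF that]])
  \<comment> \<open>Some multiple of y decomposes, and \<open>U\<close> is closed under central
    multiples, so every multiple of that denominator works.\<close>
  have evU: "\<forall>\<^sub>F s in S_filter. s \<in> S \<and> s \<otimes> y \<in> U" if y: "y \<in> carrier A" for y
  proof -
    obtain s k where s: "s \<in> S" "k \<in> I" "s \<otimes> y \<ominus> k \<in> W" using W(6)[OF y] by blast
    then have U: "s \<otimes> y \<in> U" using UI y S_closed by simp
    have "t \<otimes> s \<in> S \<and> (t \<otimes> s) \<otimes> y \<in> U" if t: "t \<in> S" for t
    proof -
      have "t \<otimes> (s \<otimes> y) \<in> U" using UI[OF U_mult[OF _ U]] t by simp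
      then show ?thesis using t s y S_mult S_closed by (simp add: m_assoc)
    qed
    then show ?thesis unfolding eventually_S_filter using s(1) by blast
  qed

  \<comment> \<open>\<open>E s\<close> is \<open>s\<close> times the average of the projection onto \<open>I\<close> along \<open>W\<close>, evaluated at \<open>1\<close>.\<close>
  define E where "E s = frag_lin A (\<lambda>p. fst p \<otimes> \<pi> (s \<otimes> snd p)) e" for s
  have "\<forall>\<^sub>F s in S_filter. \<forall>p \<in> Poly_Mapping.keys e. s \<in> S \<and> s \<otimes> snd p \<in> U"
    using evU keys_eD by (intro eventually_ball_finite) auto
  moreover have "S_filter \<noteq> bot"
    using eventually_S_filter[of "\<lambda>_. False"] S_one by (auto simp: trivial_limit_def)
  \<comment> \<open>The finitely many second factors of \<open>e\<close> get a common denominator;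
    the condition for \<open>\<one>\<close> provides \<open>s0 \<in> S\<close> independently of the
    keys of \<open>e\<close>.\<close>
  ultimately obtain s0 where s0: "s0 \<in> S" "\<And>p. p \<in> Poly_Mapping.keys e \<Longrightarrow> s0 \<otimes> snd p \<in> U"
    using eventually_happens[OF eventually_conj[OF _ evU[OF one_closed]]] by blast
  show ?thesis
  proof (rule that)
    show "E s0 \<in> I"
      unfolding E_def using keys_eD \<pi>I I.l_closed
      by (intro frag_lin_mem_subgroup I.is_additive_subgroup) blast
    show "s0 \<in> S" by fact
    have E: "E s \<in> carrier A" for s
      unfolding E_def using keys_eD \<pi>c by (intro frag_lin_closed) auto
    fix x assume x: "x \<in> I"
    then have xc: "x \<in> carrier A" by simp
    \<comment> \<open>The two sides of x e = e x under the map u \<otimes> v -> u \<pi>(s v), which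
      is additive in v and balanced modulo Q once s clears the denominators of the elements
      concerned.\<close>
    let ?L = "\<lambda>s. frag_lin A (\<lambda>p. (x \<otimes> fst p) \<otimes> \<pi> (s \<otimes> snd p)) e"
    let ?M = "\<lambda>s. frag_lin A (\<lambda>p. fst p \<otimes> \<pi> (s \<otimes> (snd p \<otimes> x))) e"
    have "\<forall>\<^sub>F s in S_filter. ?L s \<ominus> ?M s \<in> Q"
    proof (rule eventually_separability[OF Q_additive, where f = "\<lambda>s u v. u \<otimes> \<pi> (s \<otimes> v)"])
      fix u u' v assume c: "u \<in> carrier A" "u' \<in> carrier A" "v \<in> carrier A"
      show "\<forall>\<^sub>F s in S_filter. (u \<oplus> u') \<otimes> \<pi> (s \<otimes> v) \<ominus> u \<otimes> \<pi> (s \<otimes> v) \<ominus> u' \<otimes> \<pi> (s \<otimes> v) \<in> Q"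
        using c \<pi>c by (simp add: l_distr add_minus_minus_self)
    next
      fix u v v' assume c: "u \<in> carrier A" "v \<in> carrier A" "v' \<in> carrier A"
      show "\<forall>\<^sub>F s in S_filter. u \<otimes> \<pi> (s \<otimes> (v \<oplus> v')) \<ominus> u \<otimes> \<pi> (s \<otimes> v) \<ominus> u \<otimes> \<pi> (s \<otimes> v') \<in> Q"
        using evU[OF c(2)] evU[OF c(3)]
      proof eventually_elim
        case (elim s)
        then have s: "s \<in> carrier A" using S_closed by blast
        have "u \<otimes> \<pi> (s \<otimes> (v \<oplus> v')) \<ominus> u \<otimes> \<pi> (s \<otimes> v) \<ominus> u \<otimes> \<pi> (s \<otimes> v')
            = u \<otimes> (\<pi> (s \<otimes> v \<oplus> s \<otimes> v') \<ominus> (\<pi> (s \<otimes> v) \<oplus> \<pi> (s \<otimes> v')))"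
          using c s \<pi>c by (simp add: a_minus_def r_distr r_minus minus_add a_assoc)
        then show ?case
          using Q.I_l_closed[OF \<pi>_add] elim c by simp
      qed
    next
      fix u k v assume c: "u \<in> carrier A" "k \<in> Z" "v \<in> carrier A"
      show "\<forall>\<^sub>F s in S_filter. u \<otimes> k \<otimes> \<pi> (s \<otimes> v) \<ominus> u \<otimes> \<pi> (s \<otimes> (k \<otimes> v)) \<in> Q"
        using evU[OF c(3)]
      proof eventually_elim
        case (elim s)
        then have s: "s \<in> carrier A" using S_closed by blast
        have k: "k \<in> carrier A" using c ring_center_closed by blast
        have "u \<otimes> k \<otimes> \<pi> (s \<otimes> v) \<ominus> u \<otimes> \<pi> (s \<otimes> (k \<otimes> v))
            = u \<otimes> (k \<otimes> \<pi> (s \<otimes> v) \<ominus> \<pi> (k \<otimes> (s \<otimes> v)))"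
          using c s k \<pi>c by (simp add: a_minus_def r_distr r_minus m_assoc ring_center_lcomm[of k])
        moreover have "k \<otimes> \<pi> (s \<otimes> v) \<ominus> \<pi> (k \<otimes> (s \<otimes> v)) \<in> Q"
          by (rule minus_mem_sym[OF Q_additive]) (use elim c k s \<pi>c \<pi>_mult in auto)
        ultimately show ?case
          using Q.I_l_closed c by simp
      qed
    qed (use xc \<pi>c in auto)
    then obtain s1 where s1: "s1 \<in> S" "\<And>t. t \<in> S \<Longrightarrow> ?L (t \<otimes> s1) \<ominus> ?M (t \<otimes> s1) \<in> Q"
      unfolding eventually_S_filter by blast
    \<comment> \<open>A multiple of \<open>s1\<close> makes the separability identity available; a
      multiple of \<open>s0\<close> makes \<pi>(s y_i) comparable with s1 \<pi>(s0 y_i).\<close>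
    define s where "s = s0 \<otimes> s1"
    have c: "s0 \<in> carrier A" "s1 \<in> carrier A" "s \<in> carrier A"
      using s0 s1 S_closed unfolding s_def by auto
    have sZ: "s \<in> Z" "s1 \<in> Z" using S_mult s0 s1 unfolding s_def by blast+
    have LM: "?L s \<ominus> ?M s \<in> Q" using s1(2)[OF s0(1)] by (simp add: s_def)
    have cl: "?L s \<in> carrier A" "?M s \<in> carrier A"
      using keys_eD xc \<pi>c by (auto intro!: frag_lin_closed)
    \<comment> \<open>As I is a left ideal, s y_i x lies in I, where \<open>\<pi>\<close> is the
      identity modulo Q; the sum becomes s x because \<open>e\<close> multiplies to 1.\<close>
    have M0: "?M s \<ominus> frag_lin A (\<lambda>p. fst p \<otimes> (s \<otimes> (snd p \<otimes> x))) e \<in> Q"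
    proof (rule frag_lin_minus_mem[OF Q_additive])
      fix p assume p: "p \<in> Poly_Mapping.keys e"
      then have "s \<otimes> (snd p \<otimes> x) \<in> I" using keys_eD x I.l_closed c by blast
      then have "fst p \<otimes> (\<pi> (s \<otimes> (snd p \<otimes> x)) \<ominus> s \<otimes> (snd p \<otimes> x)) \<in> Q"
        using p keys_eD by (intro Q.I_l_closed \<pi>_of_I) auto
      then show "fst p \<otimes> \<pi> (s \<otimes> (snd p \<otimes> x)) \<ominus> fst p \<otimes> (s \<otimes> (snd p \<otimes> x)) \<in> Q"
        using keys_eD[OF p] \<pi>c c xc by (simp add: a_minus_def r_distr r_minus)
    qed (use keys_eD \<pi>c c xc in auto)
    have M1: "frag_lin A (\<lambda>p. fst p \<otimes> (s \<otimes> (snd p \<otimes> x))) e = s \<otimes> x"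
    proof -
      have "frag_lin A (\<lambda>p. fst p \<otimes> (s \<otimes> (snd p \<otimes> x))) e = frag_lin A (\<lambda>p. (s \<otimes> (fst p \<otimes> snd p)) \<otimes> x) e"
        using keys_eD c xc by (intro frag_lin_cong) (auto simp: m_assoc ring_center_lcomm[OF sZ(1)])
      also have "\<dots> = (s \<otimes> frag_mult A e) \<otimes> x"
        unfolding frag_mult_eq_frag_lin using keys_eD c xc
        by (subst frag_lin_mult_right frag_lin_mult_left, auto)+
      finally show ?thesis using c by (simp add: mult_e)
    qed
    have M: "?M s \<ominus> s \<otimes> x \<in> Q"
      using M0 by (simp only: M1)
    \<comment> \<open>\<open>s0\<close> already clears the denominators of all y_i, so the
      additional factor \<open>s1\<close> comes out of \<open>\<pi>\<close> modulo Q.\<close>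
    have L0: "?L s \<ominus> frag_lin A (\<lambda>p. (x \<otimes> fst p) \<otimes> (s1 \<otimes> \<pi> (s0 \<otimes> snd p))) e \<in> Q"
    proof (rule frag_lin_minus_mem[OF Q_additive])
      fix p assume p: "p \<in> Poly_Mapping.keys e"
      have "s \<otimes> snd p = s1 \<otimes> (s0 \<otimes> snd p)"
        using c keys_eD[OF p] S_comm[OF s0(1) s1(1)] by (simp add: s_def m_assoc[symmetric])
      then have "(x \<otimes> fst p) \<otimes> (\<pi> (s \<otimes> snd p) \<ominus> s1 \<otimes> \<pi> (s0 \<otimes> snd p)) \<in> Q"
        using p keys_eD xc sZ s0 by (simp add: Q.I_l_closed \<pi>_mult)
      then show "x \<otimes> fst p \<otimes> \<pi> (s \<otimes> snd p) \<ominus> x \<otimes> fst p \<otimes> (s1 \<otimes> \<pi> (s0 \<otimes> snd p)) \<in> Q"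
        using keys_eD[OF p] \<pi>c c xc by (simp add: a_minus_def r_distr r_minus)
    qed (use keys_eD \<pi>c c xc in auto)
    have L1: "frag_lin A (\<lambda>p. (x \<otimes> fst p) \<otimes> (s1 \<otimes> \<pi> (s0 \<otimes> snd p))) e = s1 \<otimes> (x \<otimes> E s0)"
    proof -
      have "frag_lin A (\<lambda>p. (x \<otimes> fst p) \<otimes> (s1 \<otimes> \<pi> (s0 \<otimes> snd p))) e =
          frag_lin A (\<lambda>p. s1 \<otimes> (x \<otimes> (fst p \<otimes> \<pi> (s0 \<otimes> snd p)))) e"
        using keys_eD c xc \<pi>c
        by (intro frag_lin_cong) (auto simp: m_assoc ring_center_lcomm[OF sZ(2)])
      also have "\<dots> = s1 \<otimes> (x \<otimes> E s0)"
        unfolding E_def using keys_eD c xc \<pi>c by (subst frag_lin_mult_left, auto)+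
      finally show ?thesis .
    qed
    have L: "?L s \<ominus> s1 \<otimes> (x \<otimes> E s0) \<in> Q"
      using L0 by (simp only: L1)
    have 1: "s1 \<otimes> (x \<otimes> E s0) \<ominus> ?L s \<in> Q"
      by (rule minus_mem_sym[OF Q_additive]) (use L cl c xc E in auto)
    have 2: "s1 \<otimes> (x \<otimes> E s0) \<ominus> ?M s \<in> Q"
      by (rule minus_mem_trans[OF Q_additive, of _ "?L s"]) (use 1 LM cl c xc E in auto)
    have 3: "s1 \<otimes> (x \<otimes> E s0) \<ominus> s \<otimes> x \<in> Q"
      by (rule minus_mem_trans[OF Q_additive, of _ "?M s"]) (use 2 M cl c xc E in auto)
    have 4: "s1 \<otimes> (x \<otimes> E s0) \<ominus> s \<otimes> x = s1 \<otimes> (x \<otimes> E s0 \<ominus> s0 \<otimes> x)"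
      using c xc E S_comm[OF s0(1) s1(1)]
      by (simp add: a_minus_def r_distr r_minus s_def m_assoc[symmetric])
    \<comment> \<open>\<open>s1\<close> depends on x and is cancelled by saturation; the remaining
      denominator \<open>s0\<close> serves all x at once.\<close>
    show "x \<otimes> E s0 \<ominus> s0 \<otimes> x \<in> Q"
    proof (rule Q_saturated[OF s1(1)])
      show "x \<otimes> E s0 \<ominus> s0 \<otimes> x \<in> carrier A" using c xc E by simp
      show "s1 \<otimes> (x \<otimes> E s0 \<ominus> s0 \<otimes> x) \<in> Q" using 3 unfolding 4 .
    qed
  qed
qed


section \<open>Ideals and maximal left ideals versus the center\<close>

text \<open>This is simplicity over the fraction field. For x in J also x x_j lies in J, so x x_j i
  \<equiv> d x x_j modulo Q; multiplying by y_j and summing gives x (tr i) \<equiv> d x. If tr i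
  were in P, all of J would fall into Q.\<close>

lemma ideal_meets_center:
  assumes J: "ideal J A" and "\<not> J \<subseteq> Q"
  obtains r where "r \<in> J" "r \<in> S"
proof -
  interpret J: ideal J A by fact
  interpret Q: ideal Q A by (rule Q_ideal)
  obtain i d where i: "i \<in> J" and d: "d \<in> S" and X: "\<And>x. x \<in> J \<Longrightarrow> x \<otimes> i \<ominus> d \<otimes> x \<in> Q"
    by (rule left_ideal_mod_idempotent[OF ideal_imp_left_ideal[OF J]]) blast
  have c: "i \<in> carrier A" "d \<in> carrier A" "d \<in> Z" using i d S_closed by auto
  have t: "tr i \<in> J" "tr i \<in> Z" using tr_mem_ideal[OF J i] tr_center[OF c(1)] by auto
  then have tc: "tr i \<in> carrier A" using ring_center_closed by blast
  have "tr i \<notin> P"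
  proof
    assume P: "tr i \<in> P"
    have "x \<in> Q" if x: "x \<in> J" for x
    proof -
      have xc: "x \<in> carrier A" using x by simp
      have "frag_lin A (\<lambda>p. x \<otimes> (fst p \<otimes> i \<otimes> snd p)) e \<ominus> frag_lin A (\<lambda>p. (d \<otimes> x) \<otimes> (fst p \<otimes> snd p)) e \<in> Q"
      proof (rule frag_lin_minus_mem[OF Q_additive])
        fix p assume p: "p \<in> Poly_Mapping.keys e"
        have "((x \<otimes> fst p) \<otimes> i \<ominus> d \<otimes> (x \<otimes> fst p)) \<otimes> snd p \<in> Q"
          using keys_eD[OF p] x by (intro Q.I_r_closed X) (auto simp: J.I_r_closed)
        then show "x \<otimes> (fst p \<otimes> i \<otimes> snd p) \<ominus> d \<otimes> x \<otimes> (fst p \<otimes> snd p) \<in> Q"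
          using keys_eD[OF p] xc c by (simp add: a_minus_def l_distr l_minus m_assoc)
      qed (use keys_eD xc c in auto)
      moreover have "frag_lin A (\<lambda>p. x \<otimes> (fst p \<otimes> i \<otimes> snd p)) e = x \<otimes> tr i"
        unfolding tr_def using keys_eD xc c by (subst frag_lin_mult_left) auto
      moreover have "frag_lin A (\<lambda>p. (d \<otimes> x) \<otimes> (fst p \<otimes> snd p)) e = (d \<otimes> x) \<otimes> frag_mult A e"
        unfolding frag_mult_eq_frag_lin using keys_eD xc c by (subst frag_lin_mult_left) auto
      ultimately have 1: "x \<otimes> tr i \<ominus> d \<otimes> x \<in> Q" using c xc by (simp add: mult_e)
      have "x \<otimes> tr i \<in> Q"
        using P_mult_Q[OF P xc] ring_center_comm[OF t(2) xc] by simp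
      then have "x \<otimes> tr i \<ominus> (x \<otimes> tr i \<ominus> d \<otimes> x) \<in> Q"
        using 1 by (simp add: a_minus_def)
      moreover have "x \<otimes> tr i \<ominus> (x \<otimes> tr i \<ominus> d \<otimes> x) = d \<otimes> x"
        using xc c tc by (simp add: a_minus_def minus_add r_neg1 r_neg2 a_assoc[symmetric] r_neg)
      ultimately show ?thesis
        using Q_saturated[OF d xc] by simp
    qed
    with assms(2) show False by blast
  qed
  with t show ?thesis using that by blast
qed

text \<open>Let b A b lie in Q and b not. The y with y A b inside Q form a two-sided ideal
  containing b, hence also a central r outside P from the ideal generated by b. Then r b lies in Q,
  and saturation puts b into Q.\<close>

lemma Q_semiprime: "semiprime_left_ideal Q A"
proof (intro semiprime_left_ideal.intro semiprime_left_ideal_axioms.intro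
    ideal_imp_left_ideal Q_ideal)
  interpret Q: ideal Q A by (rule Q_ideal)
  fix b assume b: "b \<in> carrier A" and bQ: "\<And>x. x \<in> carrier A \<Longrightarrow> b \<otimes> x \<otimes> b \<in> Q"
  show "b \<in> Q"
  proof (rule ccontr)
    assume "b \<notin> Q"
    then have "\<not> Idl {b} \<subseteq> Q" using genideal_self'[OF b] by blast
    then obtain r where r: "r \<in> Idl {b}" "r \<in> S"
      using ideal_meets_center[OF genideal_ideal[of "{b}"]] b by blast
    let ?T = "{y \<in> carrier A. \<forall>x \<in> carrier A. y \<otimes> x \<otimes> b \<in> Q}"
    have "ideal ?T A"
    proof (rule two_sided_idealI)
      fix a y assume a: "a \<in> carrier A" and y: "y \<in> ?T"
      have "a \<otimes> y \<otimes> x \<otimes> b = a \<otimes> (y \<otimes> x \<otimes> b)" "y \<otimes> a \<otimes> x \<otimes> b = y \<otimes> (a \<otimes> x) \<otimes> b"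
        if "x \<in> carrier A" for x
        using a b y that by (simp_all add: m_assoc)
      then show "a \<otimes> y \<in> ?T" "y \<otimes> a \<in> ?T"
        using a y Q.I_l_closed by auto
    qed (use b Q.zero_closed in \<open>auto simp: l_distr\<close>)
    then have "Idl {b} \<subseteq> ?T" by (rule genideal_minimal) (use b bQ in auto)
    then have "r \<otimes> \<one> \<otimes> b \<in> Q" using r by blast
    then have "r \<otimes> b \<in> Q" using S_closed[OF r(2)] b by simp
    then show False using Q_saturated[OF r(2) b] \<open>b \<notin> Q\<close> by blast
  qed
qed

section \<open>Left ideals over the residue field of a maximal ideal\<close>

lemma maximal_inverse:
  assumes "maximalideal P (A\<lparr>carrier := Z\<rparr>)" "s \<in> S"
  obtains t where "t \<in> Z" "\<one> \<ominus> t \<otimes> s \<in> P"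
proof -
  \<comment> \<open>P + Z s is strictly larger than P, so it is all of Z; writing 1 in this form
    yields an inverse of s modulo P.\<close>
  let ?J = "{p \<oplus> t \<otimes> s | p t. p \<in> P \<and> t \<in> Z}"
  have sc: "s \<in> Z" "s \<in> carrier A" using assms(2) S_closed by auto
  have ZC: "\<And>z. z \<in> Z \<Longrightarrow> z \<in> carrier A" and PC: "\<And>p. p \<in> P \<Longrightarrow> p \<in> carrier A"
    using ring_center_closed P_subset_carrier by auto
  have "ideal ?J (A\<lparr>carrier := Z\<rparr>)"
  proof (rule center_idealI)
    show "?J \<subseteq> Z" using P_subset ring_center_add ring_center_mult sc by blast
    have "\<zero> = \<zero> \<oplus> \<zero> \<otimes> s" using sc by simp
    then show "\<zero> \<in> ?J" using P_zero ring_center_zero by blast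
  next
    fix x y assume "x \<in> ?J" "y \<in> ?J"
    then obtain p t p' t' where *: "x = p \<oplus> t \<otimes> s" "y = p' \<oplus> t' \<otimes> s" "p \<in> P" "p' \<in> P" "t \<in> Z" "t' \<in> Z"
      by blast
    then have "x \<oplus> y = (p \<oplus> p') \<oplus> (t \<oplus> t') \<otimes> s"
      using sc ZC PC by (simp add: l_distr a_ac)
    then show "x \<oplus> y \<in> ?J" using * P_add ring_center_add by blast
  next
    fix a x assume a: "a \<in> Z" "x \<in> ?J"
    then obtain p t where *: "x = p \<oplus> t \<otimes> s" "p \<in> P" "t \<in> Z" by blast
    then have "a \<otimes> x = a \<otimes> p \<oplus> (a \<otimes> t) \<otimes> s"
      using sc ZC PC a by (simp add: r_distr m_assoc)
    then show "a \<otimes> x \<in> ?J" using * a P_mult ring_center_mult by blast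
  qed
  moreover have "P \<subseteq> ?J"
  proof
    fix p assume p: "p \<in> P"
    then have "p = p \<oplus> \<zero> \<otimes> s" using sc PC by simp
    then show "p \<in> ?J" using p ring_center_zero by blast
  qed
  moreover have "?J \<subseteq> Z" using P_subset ring_center_add ring_center_mult sc by blast
  ultimately have "?J = P \<or> ?J = Z"
    using maximalideal.I_maximal[OF assms(1), of ?J] by simp
  moreover have "s = \<zero> \<oplus> \<one> \<otimes> s" using sc by simp
  then have "s \<in> ?J" using P_zero ring_center_one by blast
  ultimately have "\<one> \<in> ?J" using assms(2) ring_center_one by blast
  then obtain p t where *: "\<one> = p \<oplus> t \<otimes> s" "p \<in> P" "t \<in> Z" by blast
  have "\<one> \<ominus> t \<otimes> s = p"
    using * sc ZC PC by (simp add: a_minus_def a_assoc r_neg)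
  then show ?thesis using that * by blast
qed

text \<open>Over the field Z/P left ideals are direct summands, so one that is maximal among those
  avoiding a is maximal outright: a larger proper K contains a, and adding a complement of K to M
  would enlarge M without capturing a.\<close>

lemma exists_maximal_left_ideal:
  assumes max: "maximalideal P (A\<lparr>carrier := Z\<rparr>)"
    and J: "left_ideal J A" "Idl P \<subseteq> J" and a: "a \<in> carrier A" "a \<notin> J"
  obtains M where "maximal_left_ideal M A" "J \<subseteq> M" "a \<notin> M"
proof -
  define Js where "Js = {M. left_ideal M A \<and> J \<subseteq> M \<and> a \<notin> M}"
  have "\<exists>M \<in> Js. (\<forall>N \<in> Js. M \<subseteq> N \<longrightarrow> N = M)"
  proof (rule subset_Zorn_nonempty)
    show "Js \<noteq> {}" using J a unfolding Js_def by blast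
    fix \<C> assume C: "\<C> \<noteq> {}" "subset.chain Js \<C>"
    then have mem: "left_ideal M A" "J \<subseteq> M" "a \<notin> M" if "M \<in> \<C>" for M
      using that unfolding subset_chain_def Js_def by auto
    have "left_ideal (\<Union>\<C>) A"
    proof (rule left_idealI)
      show "\<Union>\<C> \<subseteq> carrier A"
        using additive_subgroup.a_subset[OF left_ideal.axioms(1)[OF mem(1)]] by blast
      show "\<zero> \<in> \<Union>\<C>"
        using C(1) additive_subgroup.zero_closed[OF left_ideal.axioms(1)[OF mem(1)]] by blast
    next
      fix x y assume xy: "x \<in> \<Union>\<C>" "y \<in> \<Union>\<C>"
      then obtain M N where MN: "x \<in> M" "M \<in> \<C>" "y \<in> N" "N \<in> \<C>" by blast
      then have "M \<subseteq> N \<or> N \<subseteq> M" using C(2) unfolding subset_chain_def by blast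
      then show "x \<oplus> y \<in> \<Union>\<C>"
        using MN additive_subgroup.a_closed[OF left_ideal.axioms(1)[OF mem(1)]] by blast
    next
      fix b x assume "b \<in> carrier A" "x \<in> \<Union>\<C>"
      then show "b \<otimes> x \<in> \<Union>\<C>" using left_ideal.l_closed[OF mem(1)] by blast
    qed
    moreover have "J \<subseteq> \<Union>\<C>" "a \<notin> \<Union>\<C>" using C(1) mem(2,3) by blast+
    ultimately show "\<Union>\<C> \<in> Js" unfolding Js_def by blast
  qed
  then obtain M where "M \<in> Js" and Mmax: "\<And>N. \<lbrakk>N \<in> Js; M \<subseteq> N\<rbrakk> \<Longrightarrow> N = M" by blast
  then have M: "left_ideal M A" "J \<subseteq> M" "a \<notin> M" unfolding Js_def by auto
  interpret M: left_ideal M A by (rule M(1))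
  interpret IP: ideal "Idl P" A by (rule Idl_P)
  \<comment> \<open>Elements of S are units modulo P, and the extension of P lies in M; this also
    puts Q inside M.\<close>
  have cancel: "x \<in> M" if s: "s \<in> S" and x: "x \<in> carrier A" "s \<otimes> x \<in> M" for s x
  proof -
    obtain t where t: "t \<in> Z" "\<one> \<ominus> t \<otimes> s \<in> P" by (rule maximal_inverse[OF max s])
    have c: "s \<in> carrier A" "t \<in> carrier A" using s t ring_center_closed by auto
    have "(\<one> \<ominus> t \<otimes> s) \<otimes> x \<in> M"
      using IP.I_r_closed Idl_P(2) t(2) x(1) J(2) M(2) by blast
    moreover have "t \<otimes> (s \<otimes> x) \<in> M" using M.l_closed x c by blast
    ultimately have "(\<one> \<ominus> t \<otimes> s) \<otimes> x \<oplus> t \<otimes> (s \<otimes> x) \<in> M" by simp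
    also have "(\<one> \<ominus> t \<otimes> s) \<otimes> x \<oplus> t \<otimes> (s \<otimes> x) = x"
      using c x by (simp add: a_minus_def l_distr l_minus m_assoc a_assoc l_neg)
    finally show ?thesis .
  qed
  have QM: "Q \<subseteq> M"
    using cancel J(2) M(2) unfolding Q_def by blast
  have "maximal_left_ideal M A"
  proof (intro maximal_left_ideal.intro maximal_left_ideal_axioms.intro M(1))
    show "carrier A \<noteq> M" using a M by blast
    fix K assume K: "left_ideal K A" "M \<subseteq> K"
    interpret K: left_ideal K A by (rule K(1))
    show "K = M \<or> K = carrier A"
    proof (rule ccontr)
      assume neg: "\<not> (K = M \<or> K = carrier A)"
      then have aK: "a \<in> K"
        using Mmax[of K] K M(2) unfolding Js_def by blast
      obtain k d where k: "k \<in> K" and d: "d \<in> S" and X: "\<And>x. x \<in> K \<Longrightarrow> x \<otimes> k \<ominus> d \<otimes> x \<in> Q"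
        by (rule left_ideal_mod_idempotent[OF K(1)]) blast
      have c: "k \<in> carrier A" "d \<in> carrier A" using k d S_closed by auto
      \<comment> \<open>Modulo Q, right multiplication by k/d projects A onto K; \<open>?L\<close>
        is the preimage of M, that is, M plus the kernel.\<close>
      let ?L = "{x \<in> carrier A. x \<otimes> k \<in> M}"
      have L: "left_ideal ?L A"
        by (rule left_idealI) (use c M.l_closed in \<open>auto simp: l_distr m_assoc\<close>)
      have iff: "x \<otimes> k \<in> M \<longleftrightarrow> d \<otimes> x \<in> M" if x: "x \<in> K" for x
      proof -
        have xc: "x \<in> carrier A" using x by simp
        have m: "x \<otimes> k \<ominus> d \<otimes> x \<in> M" using X[OF x] QM by blast
        have "x \<otimes> k = (x \<otimes> k \<ominus> d \<otimes> x) \<oplus> d \<otimes> x"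
          using xc c by (simp add: a_minus_def a_assoc l_neg)
        moreover have "d \<otimes> x = \<ominus> (x \<otimes> k \<ominus> d \<otimes> x) \<oplus> x \<otimes> k"
          using xc c by (simp add: a_minus_def minus_add a_assoc a_comm[of "\<ominus> (x \<otimes> k)"] l_neg)
        ultimately show ?thesis
          using m M.a_closed M.a_inv_closed by metis
      qed
      have M_sub: "M \<subseteq> ?L"
        using iff K(2) M.l_closed c by auto
      have "a \<notin> ?L"
        using iff[OF aK] cancel[OF d a(1)] M(3) by blast
      then have LM: "?L = M"
        using Mmax[of ?L] L M_sub M(2) unfolding Js_def by blast
      \<comment> \<open>d - k generates the kernel of that projection. As \<open>?L\<close> equals
        M, it lies in M and hence in K, so K contains d, a unit modulo P.\<close>
      have "(d \<ominus> k) \<otimes> k = \<ominus> (k \<otimes> k \<ominus> d \<otimes> k)"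
        using c by (simp add: a_minus_def l_distr l_minus minus_add a_comm)
      then have "(d \<ominus> k) \<otimes> k \<in> M"
        using X[OF k] QM M.a_inv_closed by auto
      then have "d \<ominus> k \<in> M" using LM c by blast
      then have "(d \<ominus> k) \<oplus> k \<in> K" using K(2) k by blast
      moreover have "(d \<ominus> k) \<oplus> k = d \<otimes> \<one>"
        using c by (simp add: a_minus_def a_assoc l_neg)
      ultimately have dK: "d \<otimes> \<one> \<in> K" by simp
      obtain t where t: "t \<in> Z" "\<one> \<ominus> t \<otimes> d \<in> P" by (rule maximal_inverse[OF max d])
      have tc: "t \<in> carrier A" using t ring_center_closed by auto
      have "\<one> \<ominus> t \<otimes> d \<in> K" using t(2) Idl_P(2) J(2) M(2) K(2) by blast
      moreover have "t \<otimes> d \<in> K" using K.l_closed[OF dK tc] c by simp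
      ultimately have "(\<one> \<ominus> t \<otimes> d) \<oplus> t \<otimes> d \<in> K" by simp
      moreover have "(\<one> \<ominus> t \<otimes> d) \<oplus> t \<otimes> d = \<one>"
        using c tc by (simp add: a_minus_def a_assoc l_neg)
      ultimately have one: "\<one> \<in> K" by simp
      have "carrier A \<subseteq> K"
      proof
        fix x assume "x \<in> carrier A"
        then show "x \<in> K" using K.l_closed[OF one] by force
      qed
      then show False using neg K.a_subset by blast
    qed
  qed
  then show ?thesis using that M by blast
qed

end

section \<open>Contraction of maximal left ideals to the center\<close>

context central_separable
begin


text \<open>For central x the u with x u in M form a left ideal above M, so it is M or A; if x y
  lies in M, the first case puts y into M and the second x.\<close>

lemma maximal_left_ideal_center_prime:
  assumes M: "maximal_left_ideal M A"
  shows "primeideal (M \<inter> Z) (A\<lparr>carrier := Z\<rparr>)"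
proof -
  interpret M: maximal_left_ideal M A by fact
  have one: "\<one> \<notin> M"
  proof
    assume "\<one> \<in> M"
    then have "carrier A \<subseteq> M" using M.l_closed[of \<one>] by force
    then show False using M.notcarr M.a_subset by blast
  qed
  show ?thesis
  proof (rule primeidealI)
    show "ideal (M \<inter> Z) (A\<lparr>carrier := Z\<rparr>)"
      using ring_center_zero ring_center_add ring_center_mult ring_center_closed M.l_closed
      by (intro center_idealI) auto
    show "cring (A\<lparr>carrier := Z\<rparr>)" by (rule ring_center_cring)
    show "carrier (A\<lparr>carrier := Z\<rparr>) \<noteq> M \<inter> Z" using one ring_center_one by auto
    fix x y
    assume "x \<in> carrier (A\<lparr>carrier := Z\<rparr>)" "y \<in> carrier (A\<lparr>carrier := Z\<rparr>)"
      and "x \<otimes>\<^bsub>A\<lparr>carrier := Z\<rparr>\<^esub> y \<in> M \<inter> Z"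
    then have xy: "x \<in> Z" "y \<in> Z" "x \<otimes> y \<in> M" by auto
    then have c: "x \<in> carrier A" "y \<in> carrier A" using ring_center_closed by auto
    let ?L = "{u \<in> carrier A. x \<otimes> u \<in> M}"
    have lc: "x \<otimes> (a \<otimes> u) = a \<otimes> (x \<otimes> u)" if "a \<in> carrier A" "u \<in> carrier A" for a u
      using ring_center_lcomm[OF xy(1) that] by simp
    have "left_ideal ?L A"
      by (rule left_idealI) (use c lc M.l_closed in \<open>auto simp: r_distr\<close>)
    moreover have "M \<subseteq> ?L" using M.l_closed c by auto
    ultimately have "?L = M \<or> ?L = carrier A" by (rule M.maximal)
    then show "x \<in> M \<inter> Z \<or> y \<in> M \<inter> Z"
    proof
      assume "?L = M"
      then show ?thesis using xy c by blast
    next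
      assume "?L = carrier A"
      then have "x \<otimes> \<one> \<in> M" by blast
      then show ?thesis using xy c by simp
    qed
  qed
qed

end

context central_separable_prime
begin


text \<open>The aim is a nonzero r in Z/P divisible by every nonzero element: dividing r by s r then
  inverts s, so Z/P is a field. Such an r comes from an element g with M g inside Q. By maximality 1
  = s u + m with m in M, and multiplying by g on the right makes g divisible by s modulo Q.\<close>

lemma maximalideal_if_contraction:
  assumes M: "maximal_left_ideal M A" and contraction: "M \<inter> Z = P"
  shows "maximalideal P (A\<lparr>carrier := Z\<rparr>)"
proof -
  interpret M: maximal_left_ideal M A by fact
  interpret Q: ideal Q A by (rule Q_ideal)
  have "Idl P \<subseteq> {x \<in> carrier A. \<forall>b \<in> carrier A. x \<otimes> b \<in> M}"
  proof (rule genideal_minimal)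
    show "ideal {x \<in> carrier A. \<forall>b \<in> carrier A. x \<otimes> b \<in> M} A"
      by (rule two_sided_idealI) (use M.l_closed in \<open>auto simp: l_distr m_assoc\<close>)
    show "P \<subseteq> {x \<in> carrier A. \<forall>b \<in> carrier A. x \<otimes> b \<in> M}"
    proof
      fix c assume "c \<in> P"
      then have c: "c \<in> M" "c \<in> Z" using contraction by auto
      then have "c \<otimes> b \<in> M" if "b \<in> carrier A" for b
        using M.l_closed[OF c(1) that] ring_center_comm[OF c(2) that] by simp
      then show "c \<in> {x \<in> carrier A. \<forall>b \<in> carrier A. x \<otimes> b \<in> M}"
        using ring_center_closed[OF c(2)] by blast
    qed
  qed
  then have "x \<in> carrier A" "x \<otimes> \<one> \<in> M" if "x \<in> Idl P" for x
    using that by blast+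
  then have IM: "x \<in> M" if "x \<in> Idl P" for x
    using that by simp
  \<comment> \<open>The denominator s lies outside M, so the left ideal of all u with s u in M is
    proper and equals M by maximality.\<close>
  have QM: "x \<in> M" if xQ: "x \<in> Q" for x
  proof -
    obtain s where s: "s \<in> S" "s \<otimes> x \<in> Idl P" and x: "x \<in> carrier A"
      using xQ unfolding Q_def by blast
    have sc: "s \<in> carrier A" "s \<in> Z" "s \<notin> M" using s S_closed contraction by blast+
    let ?L = "{u \<in> carrier A. s \<otimes> u \<in> M}"
    have lc: "s \<otimes> (a \<otimes> u) = a \<otimes> (s \<otimes> u)" if "a \<in> carrier A" "u \<in> carrier A" for a u
      using ring_center_lcomm[OF sc(2) that] by simp
    have "left_ideal ?L A"
      by (rule left_idealI) (use sc lc M.l_closed in \<open>auto simp: r_distr\<close>)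
    moreover have "M \<subseteq> ?L" using M.l_closed sc by auto
    ultimately have "?L = M \<or> ?L = carrier A" by (rule M.maximal)
    moreover have "\<one> \<notin> ?L" using sc by simp
    moreover have "x \<in> ?L" using IM[OF s(2)] x by blast
    moreover have "\<one> \<in> carrier A" by simp
    ultimately show ?thesis by blast
  qed
  obtain i d where i: "i \<in> M" and d: "d \<in> S" and idem: "\<And>x. x \<in> M \<Longrightarrow> x \<otimes> i \<ominus> d \<otimes> x \<in> Q"
    by (rule left_ideal_mod_idempotent[OF M.left_ideal_axioms]) blast
  have c: "i \<in> carrier A" "d \<in> carrier A" "d \<in> Z" using i d S_closed by auto
  \<comment> \<open>Up to the factor d this is one minus the idempotent of M. It is not in Q, since
    otherwise d would lie in both M and Z, that is, in P.\<close>
  let ?g = "d \<ominus> i"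
  have gc: "?g \<in> carrier A" using c by simp
  have "?g \<notin> Q"
  proof
    assume "?g \<in> Q"
    then have "?g \<oplus> i \<in> M" using QM i by blast
    then show False using c d contraction by (auto simp: a_minus_def a_assoc l_neg)
  qed
  then have "\<not> Idl {?g} \<subseteq> Q" using genideal_self'[OF gc] by blast
  then obtain r where r: "r \<in> Idl {?g}" "r \<in> S"
    using ideal_meets_center[OF genideal_ideal[of "{?g}"]] gc by blast
  have rc: "r \<in> carrier A" "r \<in> Z" using r S_closed by auto
  have div: "\<exists>v \<in> Z. r \<ominus> s \<otimes> v \<in> P" if s: "s \<in> S" for s
  proof -
    have sc: "s \<in> carrier A" "s \<in> Z" using s S_closed by auto
    have lc: "a \<otimes> (s \<otimes> u) = s \<otimes> (a \<otimes> u)" if "a \<in> carrier A" "u \<in> carrier A" for a u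
      using ring_center_lcomm[OF sc(2) that] .
    \<comment> \<open>The elements divisible by s modulo Q. They form a two-sided ideal because s is
      central, so r belongs to it once g does.\<close>
    let ?T = "{y \<in> carrier A. \<exists>v \<in> carrier A. y \<ominus> s \<otimes> v \<in> Q}"
    have "ideal ?T A"
    proof (rule two_sided_idealI)
      show "\<zero> \<in> ?T" using sc by (auto intro!: bexI[of _ \<zero>] simp: a_minus_def)
    next
      fix x y assume "x \<in> ?T" "y \<in> ?T"
      then obtain v w where *: "x \<in> carrier A" "y \<in> carrier A" "v \<in> carrier A" "w \<in> carrier A"
        "x \<ominus> s \<otimes> v \<in> Q" "y \<ominus> s \<otimes> w \<in> Q" by blast
      have "(x \<oplus> y) \<ominus> s \<otimes> (v \<oplus> w) = (x \<ominus> s \<otimes> v) \<oplus> (y \<ominus> s \<otimes> w)"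
        using * sc by (simp add: a_minus_def r_distr minus_add a_ac)
      then have "(x \<oplus> y) \<ominus> s \<otimes> (v \<oplus> w) \<in> Q" using *(5,6) by simp
      then show "x \<oplus> y \<in> ?T" using * by blast
    next
      fix a x assume a: "a \<in> carrier A" and "x \<in> ?T"
      then obtain v where *: "x \<in> carrier A" "v \<in> carrier A" "x \<ominus> s \<otimes> v \<in> Q" by blast
      have "a \<otimes> x \<ominus> s \<otimes> (a \<otimes> v) = a \<otimes> (x \<ominus> s \<otimes> v)" "x \<otimes> a \<ominus> s \<otimes> (v \<otimes> a) = (x \<ominus> s \<otimes> v) \<otimes> a"
        using * sc a by (simp_all add: a_minus_def r_distr l_distr r_minus l_minus m_assoc lc)
      then have "a \<otimes> x \<ominus> s \<otimes> (a \<otimes> v) \<in> Q" "x \<otimes> a \<ominus> s \<otimes> (v \<otimes> a) \<in> Q"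
        using *(3) a Q.I_l_closed Q.I_r_closed by auto
      then show "a \<otimes> x \<in> ?T" "x \<otimes> a \<in> ?T" using * a by blast+
    qed blast
    moreover have "?g \<in> ?T"
    proof -
      let ?L = "{s \<otimes> u \<oplus> m | u m. u \<in> carrier A \<and> m \<in> M}"
      have L: "left_ideal ?L A"
      proof (rule left_idealI)
        show "?L \<subseteq> carrier A" using sc by auto
        have "\<zero> = s \<otimes> \<zero> \<oplus> \<zero>" using sc by simp
        then show "\<zero> \<in> ?L" using M.zero_closed by blast
      next
        fix x y assume "x \<in> ?L" "y \<in> ?L"
        then obtain u m u' m' where *: "x = s \<otimes> u \<oplus> m" "y = s \<otimes> u' \<oplus> m'" "u \<in> carrier A" "u' \<in> carrier A"
          "m \<in> M" "m' \<in> M" by blast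
        then have "x \<oplus> y = s \<otimes> (u \<oplus> u') \<oplus> (m \<oplus> m')"
          using sc by (simp add: r_distr a_ac)
        then show "x \<oplus> y \<in> ?L" using * M.a_closed by blast
      next
        fix a x assume a: "a \<in> carrier A" and "x \<in> ?L"
        then obtain u m where *: "x = s \<otimes> u \<oplus> m" "u \<in> carrier A" "m \<in> M" by blast
        then have "a \<otimes> x = s \<otimes> (a \<otimes> u) \<oplus> a \<otimes> m"
          using sc a by (simp add: r_distr lc)
        then show "a \<otimes> x \<in> ?L" using * a M.l_closed by blast
      qed
      moreover have "M \<subseteq> ?L"
      proof
        fix m assume m: "m \<in> M"
        then have "m = s \<otimes> \<zero> \<oplus> m" using sc by simp
        then show "m \<in> ?L" using m by blast
      qed
      ultimately have "?L = M \<or> ?L = carrier A" by (rule M.maximal)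
      moreover have "s = s \<otimes> \<one> \<oplus> \<zero>" using sc by simp
      then have "s \<in> ?L" using M.zero_closed by blast
      ultimately have "\<one> \<in> ?L" using s contraction by blast
      then obtain u m where um: "\<one> = s \<otimes> u \<oplus> m" "u \<in> carrier A" "m \<in> M" by blast
      have mc: "m \<in> carrier A" using um by simp
      have "?g = \<one> \<otimes> ?g" using gc by simp
      also have "\<dots> = (s \<otimes> u \<oplus> m) \<otimes> ?g" by (subst um(1)) (rule refl)
      also have "\<dots> = s \<otimes> (u \<otimes> ?g) \<oplus> m \<otimes> ?g"
        using sc gc um mc by (simp add: l_distr m_assoc)
      finally have "?g \<ominus> s \<otimes> (u \<otimes> ?g) = m \<otimes> ?g \<oplus> s \<otimes> (u \<otimes> ?g) \<ominus> s \<otimes> (u \<otimes> ?g)"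
        using sc gc um(2) mc by (simp add: a_comm)
      also have "\<dots> = m \<otimes> ?g"
        using sc gc um(2) mc by (simp add: a_minus_def a_assoc r_neg)
      also have "\<dots> = \<ominus> (m \<otimes> i \<ominus> d \<otimes> m)"
        using c mc ring_center_comm[OF c(3) mc]
        by (simp add: a_minus_def r_distr r_minus minus_add a_comm)
      finally have "?g \<ominus> s \<otimes> (u \<otimes> ?g) = \<ominus> (m \<otimes> i \<ominus> d \<otimes> m)" .
      then have "?g \<ominus> s \<otimes> (u \<otimes> ?g) \<in> Q" using idem[OF um(3)] by simp
      then show ?thesis using gc um(2) by blast
    qed
    ultimately have "Idl {?g} \<subseteq> ?T" by (intro genideal_minimal) auto
    then obtain v where v: "v \<in> carrier A" "r \<ominus> s \<otimes> v \<in> Q" using r by blast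
    \<comment> \<open>The quotient v is only known to lie in A; the retraction replaces it by a
      central one and turns the congruence modulo Q into one modulo P.\<close>
    have "tr (r \<ominus> s \<otimes> v) = r \<ominus> s \<otimes> tr v"
      using rc sc v by (simp add: a_minus_def tr_add tr_uminus tr_mult_center tr_of_center)
    then have "r \<ominus> s \<otimes> tr v \<in> P" using tr_Q[OF v(2)] by simp
    then show ?thesis using tr_center[OF v(1)] by blast
  qed
  show ?thesis
  proof (rule maximalidealI[OF P_ideal])
    show "carrier (A\<lparr>carrier := Z\<rparr>) \<noteq> P" using S_one by auto
    fix J assume J: "ideal J (A\<lparr>carrier := Z\<rparr>)" "P \<subseteq> J" "J \<subseteq> carrier (A\<lparr>carrier := Z\<rparr>)"
    note JD = center_idealD[OF J(1)]
    show "J = P \<or> J = carrier (A\<lparr>carrier := Z\<rparr>)"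
    proof (rule disjCI)
      assume "J \<noteq> carrier (A\<lparr>carrier := Z\<rparr>)"
      show "J = P"
      proof (rule ccontr)
        assume "J \<noteq> P"
        then obtain s where s: "s \<in> J" "s \<in> S" using J(2) JD(1) by blast
        have sc: "s \<in> Z" "s \<in> carrier A" using s S_closed by auto
        \<comment> \<open>r is divided by s r rather than by s, so that r cancels and an inverse of
          s remains.\<close>
        obtain v where v: "v \<in> Z" "r \<ominus> (s \<otimes> r) \<otimes> v \<in> P" using div[OF S_mult[OF s(2) r(2)]] by blast
        have vc: "v \<in> carrier A" using v ring_center_closed by blast
        have "r \<otimes> (\<one> \<ominus> v \<otimes> s) = r \<ominus> (s \<otimes> r) \<otimes> v"
          using rc sc vc ring_center_comm[OF sc(1), of v] ring_center_comm[OF sc(1), of r]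
          by (simp add: a_minus_def r_distr r_minus m_assoc ring_center_lcomm[OF sc(1)])
        moreover have Z1: "\<one> \<ominus> v \<otimes> s \<in> Z"
          using v sc by (simp add: a_minus_def ring_center_add ring_center_one ring_center_uminus ring_center_mult)
        ultimately have "\<one> \<ominus> v \<otimes> s \<in> P"
          using P_primeD[OF rc(2) Z1] v(2) r(2) by auto
        then have "(\<one> \<ominus> v \<otimes> s) \<oplus> v \<otimes> s \<in> J"
          using J(2) JD(3) JD(4)[OF v(1) s(1)] by blast
        then have one: "\<one> \<in> J"
          using vc sc by (simp add: a_minus_def a_assoc l_neg)
        have "Z \<subseteq> J"
        proof
          fix z assume "z \<in> Z"
          then show "z \<in> J" using JD(4)[OF _ one, of z] ring_center_closed by simp
        qed
        then show False using JD(1) \<open>J \<noteq> carrier (A\<lparr>carrier := Z\<rparr>)\<close> by auto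
      qed
    qed
  qed
qed

end

context ring
begin


section \<open>Semiprime left ideals\<close>

text \<open>For central w one has w^j a x w^j a = (a x) w^(2j) a, which lies in I as soon as 2j
  \<ge> n; semiprimality then lowers the exponent from n to j.\<close>

lemma semiprime_left_ideal_power:
  assumes I: "semiprime_left_ideal I R" and w: "w \<in> ring_center R" and a: "a \<in> carrier R"
    and "w [^] (n :: nat) \<otimes> a \<in> I"
  shows "w \<otimes> a \<in> I"
  using assms(4)
proof (induction n rule: less_induct)
  case (less n)
  interpret I: semiprime_left_ideal I R by fact
  have wc: "w \<in> carrier R" using w ring_center_closed by blast
  consider "n = 0" | "n = 1" | "n \<ge> 2" by linarith
  then show ?case
  proof cases
    case 1
    then show ?thesis using less.prems a I.l_closed[OF _ wc] by simp
  next
    case 2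
    then show ?thesis using less.prems wc by simp
  next
    case 3
    \<comment> \<open>Rounding up gives 2j \<ge> n, and n \<ge> 2 makes j smaller than n.\<close>
    define j where "j = (n + 1) div 2"
    have j: "j < n" "n \<le> j + j" using 3 by (auto simp: j_def)
    have pow: "w [^] k \<in> ring_center R" for k :: nat
      by (induction k) (auto simp: w ring_center_one ring_center_mult)
    have pc: "w [^] k \<in> carrier R" for k :: nat using wc by simp
    have "w [^] j \<otimes> a \<in> I"
    proof (rule I.semiprime)
      show "w [^] j \<otimes> a \<in> carrier R" using pc a by simp
      fix x assume x: "x \<in> carrier R"
      obtain m where m: "j + j = m + n" using j(2) le_Suc_ex[of n "j + j"] by (auto simp: add.commute)
      have "w [^] j \<otimes> a \<otimes> x \<otimes> (w [^] j \<otimes> a) = w [^] j \<otimes> ((a \<otimes> x) \<otimes> (w [^] j \<otimes> a))"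
        using pc a x by (simp add: m_assoc)
      also have "\<dots> = (a \<otimes> x) \<otimes> (w [^] j \<otimes> (w [^] j \<otimes> a))"
        using pc a x by (intro ring_center_lcomm[OF pow, symmetric]) auto
      also have "w [^] j \<otimes> (w [^] j \<otimes> a) = (w [^] m \<otimes> w [^] n) \<otimes> a"
        using pc a nat_pow_mult[OF wc, of j j] nat_pow_mult[OF wc, of m n] m
        by (simp add: m_assoc[symmetric])
      also have "(a \<otimes> x) \<otimes> ((w [^] m \<otimes> w [^] n) \<otimes> a) = (a \<otimes> x \<otimes> w [^] m) \<otimes> (w [^] n \<otimes> a)"
        using pc a x by (simp add: m_assoc)
      finally have eq: "w [^] j \<otimes> a \<otimes> x \<otimes> (w [^] j \<otimes> a) = (a \<otimes> x \<otimes> w [^] m) \<otimes> (w [^] n \<otimes> a)" .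
      show "w [^] j \<otimes> a \<otimes> x \<otimes> (w [^] j \<otimes> a) \<in> I"
        unfolding eq by (rule I.l_closed[OF less.prems]) (use pc a x in auto)
    qed
    then show ?thesis by (rule less.IH[OF j(1)])
  qed
qed

text \<open>P is the complement in the center of a multiplicative set T maximal among those whose
  elements do not carry a into I. For c in P, maximality provides u in T and a power with u c^n a in
  I, and semiprimality removes the power.\<close>

lemma semiprime_left_ideal_prime:
  assumes I: "semiprime_left_ideal I R" and a: "a \<in> carrier R" "a \<notin> I"
  obtains P where "primeideal P (R\<lparr>carrier := ring_center R\<rparr>)"
    "\<And>r. \<lbrakk>r \<in> ring_center R; r \<otimes> a \<in> I\<rbrakk> \<Longrightarrow> r \<in> P"
    "\<And>c. c \<in> P \<Longrightarrow> \<exists>u \<in> ring_center R - P. (u \<otimes> c) \<otimes> a \<in> I"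
proof -
  interpret I: semiprime_left_ideal I R by fact
  let ?Z = "ring_center R"
  have ZC: "\<And>z. z \<in> ?Z \<Longrightarrow> z \<in> carrier R" by (rule ring_center_closed)
  have comm: "x \<otimes> y = y \<otimes> x" if "x \<in> ?Z" "y \<in> ?Z" for x y
    using ring_center_comm[OF that(2)] ZC[OF that(1)] by simp
  define Ss where "Ss = {T. T \<subseteq> ?Z \<and> \<one> \<in> T \<and> (\<forall>s \<in> T. \<forall>t \<in> T. s \<otimes> t \<in> T) \<and> (\<forall>s \<in> T. s \<otimes> a \<notin> I)}"
  have "\<exists>T \<in> Ss. (\<forall>V \<in> Ss. T \<subseteq> V \<longrightarrow> V = T)"
  proof (rule subset_Zorn_nonempty)
    have "{\<one>} \<in> Ss" using a ring_center_one by (simp add: Ss_def)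
    then show "Ss \<noteq> {}" by blast
    fix \<C> assume C: "\<C> \<noteq> {}" "subset.chain Ss \<C>"
    then have mem: "T \<subseteq> ?Z" "\<one> \<in> T" "\<And>s t. \<lbrakk>s \<in> T; t \<in> T\<rbrakk> \<Longrightarrow> s \<otimes> t \<in> T"
      "\<And>s. s \<in> T \<Longrightarrow> s \<otimes> a \<notin> I" if "T \<in> \<C>" for T
      using that unfolding subset_chain_def Ss_def by auto
    have "s \<otimes> t \<in> \<Union>\<C>" if st: "s \<in> \<Union>\<C>" "t \<in> \<Union>\<C>" for s t
    proof -
      obtain T V where TV: "s \<in> T" "T \<in> \<C>" "t \<in> V" "V \<in> \<C>" using st by blast
      then have "T \<subseteq> V \<or> V \<subseteq> T" using C(2) unfolding subset_chain_def by blast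
      then show ?thesis using TV mem(3) by blast
    qed
    moreover have "\<Union>\<C> \<subseteq> ?Z" using mem(1) by blast
    moreover have "\<one> \<in> \<Union>\<C>" using C(1) mem(2) by blast
    moreover have "s \<otimes> a \<notin> I" if "s \<in> \<Union>\<C>" for s using that mem(4) by blast
    ultimately show "\<Union>\<C> \<in> Ss" unfolding Ss_def by simp
  qed
  then obtain T where "T \<in> Ss" and max: "\<And>V. \<lbrakk>V \<in> Ss; T \<subseteq> V\<rbrakk> \<Longrightarrow> V = T" by blast
  then have T: "T \<subseteq> ?Z" "\<one> \<in> T" "\<And>s t. \<lbrakk>s \<in> T; t \<in> T\<rbrakk> \<Longrightarrow> s \<otimes> t \<in> T"
    "\<And>s. s \<in> T \<Longrightarrow> s \<otimes> a \<notin> I" unfolding Ss_def by auto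
  have TC: "t \<in> carrier R" if "t \<in> T" for t using that T(1) ZC by blast
  have annihilate: "\<exists>u \<in> T. (u \<otimes> c) \<otimes> a \<in> I" if c: "c \<in> ?Z" "c \<notin> T" for c
  proof -
    have cc: "c \<in> carrier R" using c ZC by blast
    have pow: "c [^] k \<in> ?Z" for k :: nat
      by (induction k) (auto simp: c ring_center_one ring_center_mult)
    have pc: "c [^] k \<in> carrier R" for k :: nat using cc by simp
    \<comment> \<open>The multiplicative set generated by T and c exceeds T, so by maximality some
      element of it carries a into I.\<close>
    let ?V = "{u \<otimes> c [^] (n :: nat) | u n. u \<in> T}"
    have "u = u \<otimes> c [^] (0 :: nat)" if "u \<in> T" for u using TC[OF that] by simp
    then have TV: "T \<subseteq> ?V" by blast
    have "c = \<one> \<otimes> c [^] (1 :: nat)" using cc by simp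
    then have "c \<in> ?V" using T(2) by blast
    then have "?V \<notin> Ss" using max[OF _ TV] c(2) by blast
    moreover have "?V \<subseteq> ?Z" using T(1) pow ring_center_mult by blast
    moreover have "\<one> \<in> ?V" using TV T(2) by blast
    moreover have "s \<otimes> t \<in> ?V" if "s \<in> ?V" "t \<in> ?V" for s t
    proof -
      obtain u n v m where *: "s = u \<otimes> c [^] (n :: nat)" "t = v \<otimes> c [^] (m :: nat)" "u \<in> T" "v \<in> T"
        using \<open>s \<in> ?V\<close> \<open>t \<in> ?V\<close> by blast
      have vZ: "v \<in> ?Z" using *(4) T(1) by blast
      have "s \<otimes> t = (u \<otimes> v) \<otimes> (c [^] n \<otimes> c [^] m)"
        using TC[OF *(3)] TC[OF *(4)] pc by (simp add: *(1,2) m_assoc ring_center_lcomm[OF vZ])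
      also have "\<dots> = (u \<otimes> v) \<otimes> c [^] (n + m)" by (simp add: nat_pow_mult[OF cc])
      finally show ?thesis using T(3)[OF *(3,4)] by blast
    qed
    ultimately have "\<exists>s \<in> ?V. s \<otimes> a \<in> I" unfolding Ss_def by blast
    then obtain u n where u: "u \<in> T" "u \<otimes> c [^] (n :: nat) \<otimes> a \<in> I" by blast
    have uZ: "u \<in> ?Z" using u T(1) by blast
    have uc: "u \<in> carrier R" using TC u by blast
    have "(u \<otimes> c) \<otimes> a \<in> I"
    proof (rule semiprime_left_ideal_power[OF I ring_center_mult[OF uZ c(1)] a(1)])
      \<comment> \<open>The exponent n + 1 allows a factor u c^n to be split off also when n =
        0.\<close>
      have "(u \<otimes> c) [^] Suc n = u [^] n \<otimes> c \<otimes> (u \<otimes> c [^] n)"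
      proof -
        have "(u \<otimes> c) [^] Suc n = u [^] n \<otimes> c [^] n \<otimes> (u \<otimes> c)"
          using pow_mult_distrib[OF comm[OF uZ c(1)] uc cc, of n] by simp
        also have "\<dots> = u [^] n \<otimes> (u \<otimes> (c [^] n \<otimes> c))"
          using uc cc pc by (simp add: m_assoc ring_center_lcomm[OF uZ, of "c [^] n"])
        also have "\<dots> = u [^] n \<otimes> c \<otimes> (u \<otimes> c [^] n)"
          using uc cc pc comm[OF pow[of n] c(1)] by (simp add: m_assoc ring_center_lcomm[OF uZ, of c])
        finally show ?thesis .
      qed
      then have "(u \<otimes> c) [^] Suc n \<otimes> a = (u [^] n \<otimes> c) \<otimes> (u \<otimes> c [^] n \<otimes> a)"
        using uc cc pc a by (simp add: m_assoc)
      then show "(u \<otimes> c) [^] Suc n \<otimes> a \<in> I"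
        using I.l_closed[OF u(2), of "u [^] n \<otimes> c"] uc cc by simp
    qed
    then show ?thesis using u by blast
  qed
  let ?P = "?Z - T"
  have "primeideal ?P (R\<lparr>carrier := ?Z\<rparr>)"
  proof (rule primeidealI)
    show "ideal ?P (R\<lparr>carrier := ?Z\<rparr>)"
    proof (rule center_idealI)
      show "\<zero> \<in> ?P" using ring_center_zero T(4)[of \<zero>] a by auto
    next
      fix x y assume xy: "x \<in> ?P" "y \<in> ?P"
      obtain u where u: "u \<in> T" "u \<otimes> x \<otimes> a \<in> I" using annihilate xy by blast
      obtain v where v: "v \<in> T" "v \<otimes> y \<otimes> a \<in> I" using annihilate xy by blast
      have c: "u \<in> carrier R" "v \<in> carrier R" "x \<in> carrier R" "y \<in> carrier R"
        using u v TC xy ZC by auto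
      have uZ: "u \<in> ?Z" using u T(1) by blast
      \<comment> \<open>If x + y were in T, so would be u v (x + y); yet this carries a into I, u
        taking care of x and v of y.\<close>
      show "x \<oplus> y \<in> ?P"
      proof (rule ccontr)
        assume "x \<oplus> y \<notin> ?P"
        then have "x \<oplus> y \<in> T" using xy ring_center_add by blast
        then have T': "(u \<otimes> v) \<otimes> (x \<oplus> y) \<in> T" using T(3) u v by blast
        have "(u \<otimes> v) \<otimes> (x \<oplus> y) \<otimes> a = v \<otimes> (u \<otimes> x \<otimes> a) \<oplus> u \<otimes> (v \<otimes> y \<otimes> a)"
          using c a by (simp add: r_distr l_distr m_assoc ring_center_lcomm[OF uZ, of v])
        then have "(u \<otimes> v) \<otimes> (x \<oplus> y) \<otimes> a \<in> I"
          using I.l_closed[OF u(2) c(2)] I.l_closed[OF v(2) c(1)] by simp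
        then show False using T(4)[OF T'] by blast
      qed
    next
      fix z x assume z: "z \<in> ?Z" and x: "x \<in> ?P"
      obtain u where u: "u \<in> T" "u \<otimes> x \<otimes> a \<in> I" using annihilate x by blast
      have c: "u \<in> carrier R" "z \<in> carrier R" "x \<in> carrier R" using u TC x z ZC by auto
      show "z \<otimes> x \<in> ?P"
      proof (rule ccontr)
        assume "z \<otimes> x \<notin> ?P"
        then have "z \<otimes> x \<in> T" using x z ring_center_mult by blast
        then have T': "u \<otimes> (z \<otimes> x) \<in> T" using T(3) u by blast
        have "u \<otimes> (z \<otimes> x) \<otimes> a = z \<otimes> (u \<otimes> x \<otimes> a)"
          using c a by (simp add: m_assoc ring_center_lcomm[OF z])
        then have "u \<otimes> (z \<otimes> x) \<otimes> a \<in> I" using I.l_closed[OF u(2) c(2)] by simp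
        then show False using T(4)[OF T'] by blast
      qed
    qed blast
    show "cring (R\<lparr>carrier := ?Z\<rparr>)" by (rule ring_center_cring)
    show "carrier (R\<lparr>carrier := ?Z\<rparr>) \<noteq> ?P" using T(2) ring_center_one by auto
    fix x y
    assume "x \<in> carrier (R\<lparr>carrier := ?Z\<rparr>)" "y \<in> carrier (R\<lparr>carrier := ?Z\<rparr>)"
      and "x \<otimes>\<^bsub>R\<lparr>carrier := ?Z\<rparr>\<^esub> y \<in> ?P"
    then show "x \<in> ?P \<or> y \<in> ?P" using T(3) by auto
  qed
  moreover have "r \<in> ?P" if "r \<in> ?Z" "r \<otimes> a \<in> I" for r using that T(4) by blast
  moreover have "\<exists>u \<in> ?Z - ?P. (u \<otimes> c) \<otimes> a \<in> I" if "c \<in> ?P" for c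
    using annihilate[of c] that T(1) by blast
  ultimately show ?thesis by (rule that)
qed

end

section \<open>From a prime of the center to larger ideals\<close>

context central_separable_prime
begin


text \<open>By \<open>P2\<close> each c in P carries a into I up to a factor from S; this spreads to
  y A a for y in the extension of P, with one factor u for each y. For y = w = s a - i, the last
  factor of (u w) x (u w) splits into u s a, covered by this, and u i in I. Semiprimality gives u w
  in I, so u s a in I, and \<open>P1\<close> puts u s into P.\<close>

lemma not_mem_left_ideal_plus:
  assumes I: "semiprime_left_ideal I A" and a: "a \<in> carrier A"
    and P1: "\<And>r. \<lbrakk>r \<in> Z; r \<otimes> a \<in> I\<rbrakk> \<Longrightarrow> r \<in> P"
    and P2: "\<And>c. c \<in> P \<Longrightarrow> \<exists>u \<in> S. (u \<otimes> c) \<otimes> a \<in> I"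
    and s: "s \<in> S" and i: "i \<in> I"
  shows "s \<otimes> a \<ominus> i \<notin> Idl P"
proof
  interpret I: semiprime_left_ideal I A by fact
  let ?w = "s \<otimes> a \<ominus> i"
  let ?T = "{y \<in> carrier A. \<exists>u \<in> S. \<forall>x \<in> carrier A. u \<otimes> (y \<otimes> x \<otimes> a) \<in> I}"
  have ic: "i \<in> carrier A" using i by simp
  have sc: "s \<in> carrier A" using S_closed s by blast
  have "ideal ?T A"
  proof (rule two_sided_idealI)
    have "\<one> \<otimes> (\<zero> \<otimes> x \<otimes> a) \<in> I" if "x \<in> carrier A" for x using that a by simp
    then show "\<zero> \<in> ?T" using S_one by blast
  next
    fix y y' assume "y \<in> ?T" "y' \<in> ?T"
    then obtain u v where *: "y \<in> carrier A" "y' \<in> carrier A" "u \<in> S" "v \<in> S"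
      "\<And>x. x \<in> carrier A \<Longrightarrow> u \<otimes> (y \<otimes> x \<otimes> a) \<in> I" "\<And>x. x \<in> carrier A \<Longrightarrow> v \<otimes> (y' \<otimes> x \<otimes> a) \<in> I"
      by blast
    have c: "u \<in> carrier A" "v \<in> carrier A" "u \<in> Z" using * S_closed by auto
    have "(u \<otimes> v) \<otimes> ((y \<oplus> y') \<otimes> x \<otimes> a) \<in> I" if x: "x \<in> carrier A" for x
    proof -
      have "(u \<otimes> v) \<otimes> ((y \<oplus> y') \<otimes> x \<otimes> a) = v \<otimes> (u \<otimes> (y \<otimes> x \<otimes> a)) \<oplus> u \<otimes> (v \<otimes> (y' \<otimes> x \<otimes> a))"
        using * c x a by (simp add: r_distr l_distr m_assoc ring_center_lcomm[OF c(3), of v])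
      then show ?thesis
        using I.l_closed[OF *(5)[OF x] c(2)] I.l_closed[OF *(6)[OF x] c(1)] by simp
    qed
    then show "y \<oplus> y' \<in> ?T" using * S_mult by blast
  next
    fix b y assume b: "b \<in> carrier A" and "y \<in> ?T"
    then obtain u where *: "y \<in> carrier A" "u \<in> S" "\<And>x. x \<in> carrier A \<Longrightarrow> u \<otimes> (y \<otimes> x \<otimes> a) \<in> I" by blast
    have c: "u \<in> carrier A" "u \<in> Z" using * S_closed by auto
    have "u \<otimes> (b \<otimes> y \<otimes> x \<otimes> a) \<in> I" "u \<otimes> (y \<otimes> b \<otimes> x \<otimes> a) \<in> I" if x: "x \<in> carrier A" for x
    proof -
      have "u \<otimes> (b \<otimes> y \<otimes> x \<otimes> a) = b \<otimes> (u \<otimes> (y \<otimes> x \<otimes> a))"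
        using * c x a b by (simp add: m_assoc ring_center_lcomm[OF c(2), of b])
      then show "u \<otimes> (b \<otimes> y \<otimes> x \<otimes> a) \<in> I" using I.l_closed[OF *(3)[OF x] b] by simp
      have "u \<otimes> (y \<otimes> b \<otimes> x \<otimes> a) = u \<otimes> (y \<otimes> (b \<otimes> x) \<otimes> a)"
        using * c x a b by (simp add: m_assoc)
      then show "u \<otimes> (y \<otimes> b \<otimes> x \<otimes> a) \<in> I" using *(3)[of "b \<otimes> x"] b x by simp
    qed
    then show "b \<otimes> y \<in> ?T" "y \<otimes> b \<in> ?T" using * b by blast+
  qed blast
  moreover have "P \<subseteq> ?T"
  proof
    fix c assume c: "c \<in> P"
    then obtain u where u: "u \<in> S" "(u \<otimes> c) \<otimes> a \<in> I" using P2 by blast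
    have cc: "c \<in> carrier A" "c \<in> Z" "u \<in> carrier A" "u \<in> Z"
      using c P_subset P_subset_carrier u S_closed by auto
    have "u \<otimes> (c \<otimes> x \<otimes> a) \<in> I" if x: "x \<in> carrier A" for x
    proof -
      have "u \<otimes> (c \<otimes> x \<otimes> a) = x \<otimes> ((u \<otimes> c) \<otimes> a)"
        using cc x a by (simp add: m_assoc ring_center_lcomm[OF cc(2), of x] ring_center_lcomm[OF cc(4), of x])
      then show ?thesis using I.l_closed[OF u(2) x] by simp
    qed
    then show "c \<in> ?T" using u cc by blast
  qed
  ultimately have "Idl P \<subseteq> ?T" by (rule genideal_minimal)
  moreover assume "?w \<in> Idl P"
  ultimately obtain u where u: "u \<in> S" "\<And>x. x \<in> carrier A \<Longrightarrow> u \<otimes> (?w \<otimes> x \<otimes> a) \<in> I" by blast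
  have c: "u \<in> carrier A" "u \<in> Z" "s \<in> Z" using u S_closed s by auto
  have wc: "?w \<in> carrier A" using sc a ic by simp
  have "u \<otimes> ?w \<in> I"
  proof (rule I.semiprime)
    show "u \<otimes> ?w \<in> carrier A" using c wc by simp
    fix x assume x: "x \<in> carrier A"
    have eq: "u \<otimes> ?w \<otimes> x \<otimes> (u \<otimes> ?w) = (u \<otimes> s) \<otimes> (u \<otimes> (?w \<otimes> x \<otimes> a)) \<oplus> \<ominus> ((u \<otimes> ?w \<otimes> x \<otimes> u) \<otimes> i)"
    proof -
      define w where "w = ?w"
      have w: "w \<in> carrier A" using wc by (simp add: w_def)
      have "u \<otimes> w \<otimes> x \<otimes> (u \<otimes> (s \<otimes> a \<ominus> i)) = u \<otimes> w \<otimes> x \<otimes> (u \<otimes> (s \<otimes> a)) \<oplus> \<ominus> ((u \<otimes> w \<otimes> x \<otimes> u) \<otimes> i)"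
        using c sc w x a ic by (simp add: a_minus_def r_distr r_minus m_assoc)
      moreover have "u \<otimes> w \<otimes> x \<otimes> (u \<otimes> (s \<otimes> a)) = (u \<otimes> s) \<otimes> (u \<otimes> (w \<otimes> x \<otimes> a))"
      proof -
        have "u \<otimes> w \<otimes> x \<otimes> (u \<otimes> (s \<otimes> a)) = u \<otimes> (w \<otimes> (x \<otimes> (u \<otimes> (s \<otimes> a))))"
          using c sc w x a by (simp add: m_assoc)
        also have "\<dots> = u \<otimes> (u \<otimes> (s \<otimes> (w \<otimes> (x \<otimes> a))))"
          using c sc w x a by (simp add: ring_center_lcomm[OF c(2), of x] ring_center_lcomm[OF c(2), of w]
              ring_center_lcomm[OF c(3), of x] ring_center_lcomm[OF c(3), of w])
        also have "\<dots> = (u \<otimes> s) \<otimes> (u \<otimes> (w \<otimes> x \<otimes> a))"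
          using c sc w x a by (simp add: m_assoc ring_center_lcomm[OF c(2), of s])
        finally show ?thesis .
      qed
      ultimately show ?thesis by (simp add: w_def)
    qed
    have "(u \<otimes> s) \<otimes> (u \<otimes> (?w \<otimes> x \<otimes> a)) \<in> I"
      by (rule I.l_closed[OF u(2)[OF x]]) (use c sc in simp)
    moreover have "(u \<otimes> ?w \<otimes> x \<otimes> u) \<otimes> i \<in> I"
      by (rule I.l_closed[OF i]) (use c wc x in simp)
    ultimately show "u \<otimes> ?w \<otimes> x \<otimes> (u \<otimes> ?w) \<in> I"
      unfolding eq by (intro I.a_closed I.a_inv_closed)
  qed
  then have "u \<otimes> ?w \<oplus> u \<otimes> i \<in> I" using I.l_closed[OF i c(1)] by (intro I.a_closed)
  moreover have eq: "(u \<otimes> s) \<otimes> a = u \<otimes> ?w \<oplus> u \<otimes> i"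
    using c sc a ic by (simp add: a_minus_def r_distr r_minus m_assoc a_assoc l_neg)
  ultimately have "u \<otimes> s \<in> P"
    by (intro P1 ring_center_mult c(2,3)) (simp only: eq)
  then show False using S_mult[OF u(1) s] by blast
qed

text \<open>A single central element certifies that a stays outside I at every m above P that avoids
  it. With the right identity i/d of I, the element a i - d a is the obstruction to a lying in I
  over the fraction field; it does not vanish there, so the ideal it generates meets S.\<close>

lemma exists_generic_element:
  assumes I: "left_ideal I A" and a: "a \<in> carrier A"
    and generic: "\<And>s i. \<lbrakk>s \<in> S; i \<in> I\<rbrakk> \<Longrightarrow> s \<otimes> a \<ominus> i \<notin> Idl P"
  obtains r where "r \<in> S"
    "\<And>m. \<lbrakk>ideal m (A\<lparr>carrier := Z\<rparr>); P \<subseteq> m; r \<notin> m\<rbrakk> \<Longrightarrow> a \<notin> I <+>\<^bsub>A\<^esub> Idl m"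
proof -
  interpret I: left_ideal I A by fact
  interpret Q: ideal Q A by (rule Q_ideal)
  obtain i d where i: "i \<in> I" and d: "d \<in> S" and idem: "\<And>x. x \<in> I \<Longrightarrow> x \<otimes> i \<ominus> d \<otimes> x \<in> Q"
    by (rule left_ideal_mod_idempotent[OF I]) blast
  have c: "i \<in> carrier A" "d \<in> carrier A" "d \<in> Z" using i d S_closed by auto
  let ?g = "a \<otimes> i \<ominus> d \<otimes> a"
  have gc: "?g \<in> carrier A" using a c by simp
  have "?g \<notin> Q"
  proof
    assume "?g \<in> Q"
    then obtain s where s: "s \<in> S" "s \<otimes> ?g \<in> Idl P" unfolding Q_def by blast
    have sc: "s \<in> carrier A" using s S_closed by blast
    have "\<ominus> (s \<otimes> ?g) \<in> Idl P"
      by (rule additive_subgroup.a_inv_closed[OF ideal.axioms(1)[OF Idl_P(1)] s(2)])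
    moreover have "\<ominus> (s \<otimes> ?g) = (s \<otimes> d) \<otimes> a \<ominus> (s \<otimes> a) \<otimes> i"
      using sc c a by (simp add: a_minus_def r_distr r_minus minus_add m_assoc a_comm)
    moreover have "(s \<otimes> a) \<otimes> i \<in> I" by (rule I.l_closed[OF i]) (use sc a in simp)
    ultimately show False using generic[OF S_mult[OF s(1) d], of "(s \<otimes> a) \<otimes> i"] by metis
  qed
  then have "\<not> Idl {?g} \<subseteq> Q" using genideal_self'[OF gc] by blast
  then obtain r where r: "r \<in> Idl {?g}" "r \<in> S"
    using ideal_meets_center[OF genideal_ideal[of "{?g}"]] gc by blast
  \<comment> \<open>For a = x + y with x in I and y in the extension of m, the x-part of
    \<open>?g\<close> lies in Q and the y-part in that extension. So r lies in their sum, and the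
    retraction, which fixes r, sends it into P + m = m.\<close>
  have "a \<notin> I <+>\<^bsub>A\<^esub> Idl m" if m: "ideal m (A\<lparr>carrier := Z\<rparr>)" "P \<subseteq> m" "r \<notin> m" for m
  proof
    note mD = center_idealD[OF m(1)]
    have mI: "ideal (Idl m) A" using mD(1) Z_subset by (intro genideal_ideal) blast
    interpret N: ideal "Idl m" A by (rule mI)
    assume "a \<in> I <+>\<^bsub>A\<^esub> Idl m"
    then obtain x y where xy: "x \<in> I" "y \<in> Idl m" "a = x \<oplus> y"
      unfolding set_add_def' by blast
    have xyc: "x \<in> carrier A" "y \<in> carrier A" using xy by auto
    have "?g = (x \<otimes> i \<ominus> d \<otimes> x) \<oplus> (y \<otimes> i \<ominus> d \<otimes> y)"
      using xyc c by (simp add: xy(3) a_minus_def l_distr r_distr minus_add a_ac)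
    moreover have "y \<otimes> i \<ominus> d \<otimes> y \<in> Idl m"
      using xy(2) c by (simp add: a_minus_def N.I_l_closed N.I_r_closed)
    ultimately have "?g \<in> Q <+>\<^bsub>A\<^esub> Idl m"
      using idem[OF xy(1)] unfolding set_add_def' by blast
    then have "Idl {?g} \<subseteq> Q <+>\<^bsub>A\<^esub> Idl m"
      using genideal_minimal[OF add_ideals[OF Q_ideal mI]] by simp
    then obtain q y' where qy: "q \<in> Q" "y' \<in> Idl m" "r = q \<oplus> y'"
      using r(1) unfolding set_add_def' by blast
    have "r = tr (q \<oplus> y')" using tr_of_center[of r] r(2) qy(3) by simp
    also have "\<dots> = tr q \<oplus> tr y'" using qy(1,2) by (intro tr_add) auto
    also have "\<dots> \<in> m" using tr_Q[OF qy(1)] tr_genideal[OF m(1) qy(2)] m(2) mD(3) by blast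
    finally show False using m(3) by blast
  qed
  then show ?thesis using that r(2) by blast
qed

end

lemma (in ring) left_ideal_set_add:
  assumes "left_ideal I R" "ideal J R"
  shows "left_ideal (I <+>\<^bsub>R\<^esub> J) R"
proof (intro left_ideal.intro left_ideal_axioms.intro ring_axioms)
  interpret I: left_ideal I R by fact
  interpret J: ideal J R by fact
  show "additive_subgroup (I <+>\<^bsub>R\<^esub> J) R"
    by (rule add_additive_subgroups[OF I.is_additive_subgroup J.is_additive_subgroup])
  fix x a assume x: "x \<in> I <+>\<^bsub>R\<^esub> J" and a: "a \<in> carrier R"
  obtain i j where ij: "i \<in> I" "j \<in> J" "x = i \<oplus> j"
    using x unfolding set_add_def' by blast
  then have "a \<otimes> x = a \<otimes> i \<oplus> a \<otimes> j" using a by (simp add: r_distr)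
  then show "a \<otimes> x \<in> I <+>\<^bsub>R\<^esub> J"
    using I.l_closed[OF ij(1) a] J.I_l_closed[OF ij(2) a] unfolding set_add_def' by blast
qed

section \<open>The two implications\<close>

context central_separable
begin

lemma strongly_left_jacobson_if_center_jacobson:
  assumes jac: "jacobson_cring (A\<lparr>carrier := Z\<rparr>)"
  shows "strongly_left_jacobson A"
proof (intro strongly_left_jacobson.intro strongly_left_jacobson_axioms.intro ring_axioms)
  fix I assume I: "semiprime_left_ideal I A"
  then have LI: "left_ideal I A" by (rule semiprime_left_ideal.axioms(1))
  have I_sub: "I \<subseteq> carrier A"
    using LI left_ideal.axioms(1) additive_subgroup.a_subset by blast
  let ?M = "{M. maximal_left_ideal M A \<and> I \<subseteq> M}"
  have "a \<in> I" if a: "a \<in> carrier A" and aM: "a \<in> \<Inter>?M" for a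
  proof (rule ccontr)
    assume "a \<notin> I"
    then obtain P where P: "primeideal P (A\<lparr>carrier := Z\<rparr>)"
      "\<And>r. \<lbrakk>r \<in> Z; r \<otimes> a \<in> I\<rbrakk> \<Longrightarrow> r \<in> P"
      "\<And>c. c \<in> P \<Longrightarrow> \<exists>u \<in> Z - P. (u \<otimes> c) \<otimes> a \<in> I"
      by (rule semiprime_left_ideal_prime[OF I a]) blast
    have csp: "central_separable_prime A e m" if "primeideal m (A\<lparr>carrier := Z\<rparr>)" for m
      using that by (intro central_separable_prime.intro central_separable_prime_axioms.intro
        central_separable_axioms)
    note gen = central_separable_prime.not_mem_left_ideal_plus[OF csp[OF P(1)] I a P(2,3)]
    obtain r where r: "r \<in> Z - P"
      "\<And>m. \<lbrakk>ideal m (A\<lparr>carrier := Z\<rparr>); P \<subseteq> m; r \<notin> m\<rbrakk> \<Longrightarrow> a \<notin> I <+>\<^bsub>A\<^esub> Idl m"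
      using central_separable_prime.exists_generic_element[OF csp[OF P(1)] LI a gen] by blast
    obtain \<M> where M: "\<forall>m \<in> \<M>. maximalideal m (A\<lparr>carrier := Z\<rparr>)"
      "P = carrier (A\<lparr>carrier := Z\<rparr>) \<inter> \<Inter>\<M>"
      using jacobson_cring.prime_is_Inter[OF jac P(1)] by blast
    then obtain m where m: "m \<in> \<M>" "r \<notin> m" using r(1) by auto
    then have max: "maximalideal m (A\<lparr>carrier := Z\<rparr>)" and Pm: "P \<subseteq> m" using M by auto
    have mi: "ideal m (A\<lparr>carrier := Z\<rparr>)" by (rule maximalideal.axioms(1)[OF max])
    have prime: "primeideal m (A\<lparr>carrier := Z\<rparr>)"
      by (rule cring.maximalideal_prime[OF ring_center_cring max])
    have mI: "ideal (Idl m) A"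
      using center_idealD(1)[OF mi] Z_subset by (intro genideal_ideal) blast
    \<comment> \<open>It contains m, so the theory over the field Z/m applies, and by the choice of
      r it still avoids a.\<close>
    let ?J = "I <+>\<^bsub>A\<^esub> Idl m"
    have J: "left_ideal ?J A" by (rule left_ideal_set_add[OF LI mI])
    have zI: "\<zero> \<in> I" "\<zero> \<in> Idl m"
      using additive_subgroup.zero_closed left_ideal.axioms(1)[OF LI] ideal.axioms(1)[OF mI] by blast+
    have "Idl m \<subseteq> ?J"
    proof
      fix x assume x: "x \<in> Idl m"
      then have "x = \<zero> \<oplus> x" using ideal.Icarr[OF mI] by simp
      then show "x \<in> ?J" using x zI unfolding set_add_def' by blast
    qed
    moreover have "I \<subseteq> ?J"
    proof
      fix x assume x: "x \<in> I"
      then have "x = x \<oplus> \<zero>" using I_sub by auto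
      then show "x \<in> ?J" using x zI unfolding set_add_def' by blast
    qed
    moreover have "a \<notin> ?J" by (rule r(2)[OF mi Pm m(2)])
    ultimately obtain N where "maximal_left_ideal N A" "?J \<subseteq> N" "a \<notin> N"
      using central_separable_prime.exists_maximal_left_ideal[OF csp[OF prime] max J _ a] by blast
    then show False using aM \<open>I \<subseteq> ?J\<close> by blast
  qed
  then have "I = carrier A \<inter> \<Inter>?M" using I_sub by blast
  then show "\<exists>\<M>. (\<forall>M \<in> \<M>. maximal_left_ideal M A) \<and> I = carrier A \<inter> \<Inter>\<M>"
    by (intro exI[of _ ?M]) simp
qed

lemma center_jacobson_if_strongly_left_jacobson:
  assumes jac: "strongly_left_jacobson A"
  shows "jacobson_cring (A\<lparr>carrier := Z\<rparr>)"
proof (intro jacobson_cring.intro jacobson_cring_axioms.intro ring_center_cring)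
  fix P assume P: "primeideal P (A\<lparr>carrier := Z\<rparr>)"
  have csp: "central_separable_prime A e m" if "primeideal m (A\<lparr>carrier := Z\<rparr>)" for m
    using that by (intro central_separable_prime.intro central_separable_prime_axioms.intro
      central_separable_axioms)
  let ?Q = "central_separable_prime.Q A P"
  obtain \<M> where M: "\<forall>M \<in> \<M>. maximal_left_ideal M A" "?Q = carrier A \<inter> \<Inter>\<M>"
    using strongly_left_jacobson.semiprime_is_Inter[OF jac
        central_separable_prime.Q_semiprime[OF csp[OF P]]] by blast
  \<comment> \<open>The contraction criterion is applied at the prime M \<inter> Z, which may be
    strictly larger than P.\<close>
  have "maximalideal (M \<inter> Z) (A\<lparr>carrier := Z\<rparr>)" if "M \<in> \<M>" for M
    using M(1) that maximal_left_ideal_center_prime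
    by (intro central_separable_prime.maximalideal_if_contraction[OF csp]) auto
  \<comment> \<open>Intersecting \<open>?Q\<close> with the center gives P, so the contractions of
    the maximal left ideals cutting out \<open>?Q\<close> cut out P.\<close>
  moreover have "P = Z \<inter> \<Inter>((\<lambda>M. M \<inter> Z) ` \<M>)"
    using central_separable_prime.Q_Int_Z[OF csp[OF P]] M(2) Z_subset by auto
  ultimately show "\<exists>\<M>. (\<forall>M \<in> \<M>. maximalideal M (A\<lparr>carrier := Z\<rparr>)) \<and>
      P = carrier (A\<lparr>carrier := Z\<rparr>) \<inter> \<Inter>\<M>"
    by (intro exI[of _ "(\<lambda>M. M \<inter> Z) ` \<M>"]) simp
qed

end

theorem theorem23:
  fixes A :: "('a, 'm) ring_scheme"
  assumes "azumaya_over_center A"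
  shows "strongly_left_jacobson A \<longleftrightarrow> jacobson_cring (A\<lparr>carrier := ring_center A\<rparr>)"
proof -
  have sep: "separable_algebra (ring_center A) A"
    using assms by (simp add: azumaya_over_center_def)
  then interpret ring A by (rule separable_algebra.axioms(1))
  obtain e where e: "Poly_Mapping.keys e \<subseteq> carrier A \<times> carrier A" "frag_mult A e = \<one>\<^bsub>A\<^esub>"
    "\<And>a. a \<in> carrier A \<Longrightarrow> frag_act A a \<one>\<^bsub>A\<^esub> e - frag_act A \<one>\<^bsub>A\<^esub> a e \<in> tensor_null (ring_center A) A"
    by (rule separability_element[OF sep]) blast
  have "central_separable A e"
    by (intro central_separable.intro central_separable_axioms.intro ring_axioms e)
  then show ?thesis
    using central_separable.strongly_left_jacobson_if_center_jacobson
      central_separable.center_jacobson_if_strongly_left_jacobson by blast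
qed

end
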